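(* Let $(\mathcal R,\exp)$ be an exponential field which, in the language $(+,\cdot,0,1,\leqslant,\exp)$, is a model of the complete theory $Th(\mathbb R_{\exp_2})$ of $\mathbb R_{\exp_2}=(\mathbb R,+,\cdot,0,1,\leqslant,2^x)$. Let $\mathcal M\subseteq\mathcal R$ be a discretely ordered ring and $x^y\colon M^+\times M^+\to M^+$ a function such that $(\mathcal M,x^y)$ is an $x^y$-integer part of $(\mathcal R,\exp)$. Then $(\mathcal M^+,x^y)$, with $S(x)$ interpreted as $x+1$, is a model of $\mathsf{IOpen}(x^y)$.
   Context: An exponential field is an ordered field $\mathcal F$ with a map $\exp\colon F\to F^{>0}$ that is an order-preserving isomorphism from $(F,+)$ onto $(F^{>0},\cdot)$; $\log$ denotes its inverse. A discretely ordered ring is an ordered (commutative unital) ring in which $1$ is the least positive element; $M^+=\{m\in M:m\geqslant0\}$. If $\mathcal M\subseteq\mathcal R$ with $\mathcal M$ discretely ordered, $\mathcal M$ is an integer part of $\mathcal R$ if for each $r\in R$ there is $m\in M$ with $m\leqslant r<m+1$. $(\mathcal M,x^y)$ is an $x^y$-integer part of $(\mathcal R,\exp)$ if $\mathcal M$ is an integer part of $\mathcal R$ and (1) $n^m=\exp(m\cdot\log n)$ for all $n,m\in M^+$ with $n>0$, (2) $0^0=1$, (3) $0^m=0$ for all $m\in M^{>0}$. The theory $\mathsf{IOpen}(x^y)$ in the language $(0,S,+,\cdot,\leqslant,x^y)$ consists of: (Q1) $Sx\neq 0$; (Q2) $Sx=Sy\to x=y$; (Q3) $x\neq0\to\exists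 y\,(x=Sy)$; (Q4) $x+0=x$; (Q5) $x+Sy=S(x+y)$; (Q6) $x\cdot0=0$; (Q7) $x\cdot Sy=x\cdot y+x$; (Q8) $x\leqslant y\leftrightarrow\exists r\,(r+x=y)$; (P1) $x^0=S(0)$; (P2) $y^{S(x)}=y^x\cdot y$; and the induction scheme $\big(\varphi(0,\bar y)\wedge\forall x(\varphi(x,\bar y)\to\varphi(S(x),\bar y))\big)\to\forall x\,\varphi(x,\bar y)$ for every quantifier-free formula $\varphi$ of this language. *)

theory Defs
  imports Complex_Main
begin

text \<open>First-order formulas over a type \<open>'t\<close> of terms. Both languages below have
  \<open>\<le>\<close> as their only relation symbol besides equality, so they share this datatype.
  Variables are named by natural numbers.\<close>

datatype 't fm =
    Eq 't 't
  | Le 't 't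
  | Neg "'t fm"
  | Conj "'t fm" "'t fm"
  | Forall nat "'t fm"

abbreviation Imp :: "'t fm \<Rightarrow> 't fm \<Rightarrow> 't fm" where
  "Imp p q \<equiv> Neg (Conj p (Neg q))"

abbreviation Iff :: "'t fm \<Rightarrow> 't fm \<Rightarrow> 't fm" where
  "Iff p q \<equiv> Conj (Imp p q) (Imp q p)"

abbreviation Exists :: "nat \<Rightarrow> 't fm \<Rightarrow> 't fm" where
  "Exists x p \<equiv> Neg (Forall x (Neg p))"

primrec sat ::
  "'a set \<Rightarrow> ('a \<Rightarrow> 'a \<Rightarrow> bool) \<Rightarrow> ((nat \<Rightarrow> 'a) \<Rightarrow> 't \<Rightarrow> 'a) \<Rightarrow> 't fm \<Rightarrow> (nat \<Rightarrow> 'a) \<Rightarrow> bool"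
  where
  "sat U le ev (Eq s t) v \<longleftrightarrow> ev v s = ev v t"
| "sat U le ev (Le s t) v \<longleftrightarrow> le (ev v s) (ev v t)"
| "sat U le ev (Neg p) v \<longleftrightarrow> \<not> sat U le ev p v"
| "sat U le ev (Conj p q) v \<longleftrightarrow> sat U le ev p v \<and> sat U le ev q v"
| "sat U le ev (Forall x p) v \<longleftrightarrow> (\<forall>a\<in>U. sat U le ev p (v(x := a)))"

text \<open>Truth of a formula in a structure is truth of its universal closure.\<close>

definition holds ::
  "'a set \<Rightarrow> ('a \<Rightarrow> 'a \<Rightarrow> bool) \<Rightarrow> ((nat \<Rightarrow> 'a) \<Rightarrow> 't \<Rightarrow> 'a) \<Rightarrow> 't fm \<Rightarrow> bool" where
  "holds U le ev p \<longleftrightarrow> (\<forall>v. range v \<subseteq> U \<longrightarrow> sat U le ev p v)"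

primrec free_vars :: "('t \<Rightarrow> nat set) \<Rightarrow> 't fm \<Rightarrow> nat set" where
  "free_vars tv (Eq s t) = tv s \<union> tv t"
| "free_vars tv (Le s t) = tv s \<union> tv t"
| "free_vars tv (Neg p) = free_vars tv p"
| "free_vars tv (Conj p q) = free_vars tv p \<union> free_vars tv q"
| "free_vars tv (Forall x p) = free_vars tv p - {x}"

primrec quantifier_free :: "'t fm \<Rightarrow> bool" where
  "quantifier_free (Eq s t) \<longleftrightarrow> True"
| "quantifier_free (Le s t) \<longleftrightarrow> True"
| "quantifier_free (Neg p) \<longleftrightarrow> quantifier_free p"
| "quantifier_free (Conj p q) \<longleftrightarrow> quantifier_free p \<and> quantifier_free q"
| "quantifier_free (Forall x p) \<longleftrightarrow> False"


section \<open>The language \<open>(+, \<cdot>, 0, 1, \<le>, exp)\<close> and exponential fields\<close>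

datatype eterm =
    EVar nat
  | EZero
  | EOne
  | EAdd eterm eterm
  | EMul eterm eterm
  | EExp eterm

primrec eterm_vars :: "eterm \<Rightarrow> nat set" where
  "eterm_vars (EVar x) = {x}"
| "eterm_vars EZero = {}"
| "eterm_vars EOne = {}"
| "eterm_vars (EAdd s t) = eterm_vars s \<union> eterm_vars t"
| "eterm_vars (EMul s t) = eterm_vars s \<union> eterm_vars t"
| "eterm_vars (EExp t) = eterm_vars t"

primrec eterm_eval :: "('a::linordered_field \<Rightarrow> 'a) \<Rightarrow> (nat \<Rightarrow> 'a) \<Rightarrow> eterm \<Rightarrow> 'a" where
  "eterm_eval E v (EVar x) = v x"
| "eterm_eval E v EZero = 0"
| "eterm_eval E v EOne = 1"
| "eterm_eval E v (EAdd s t) = eterm_eval E v s + eterm_eval E v t"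
| "eterm_eval E v (EMul s t) = eterm_eval E v s * eterm_eval E v t"
| "eterm_eval E v (EExp t) = E (eterm_eval E v t)"

text \<open>Truth in \<open>(F, +, \<cdot>, 0, 1, \<le>, E)\<close>, where \<open>F\<close> is the whole type \<open>'a\<close>.\<close>

definition exp_holds :: "('a::linordered_field \<Rightarrow> 'a) \<Rightarrow> eterm fm \<Rightarrow> bool" where
  "exp_holds E p \<longleftrightarrow> holds UNIV (\<le>) (eterm_eval E) p"

definition exp_models :: "('a::linordered_field \<Rightarrow> 'a) \<Rightarrow> eterm fm set \<Rightarrow> bool" where
  "exp_models E T \<longleftrightarrow> (\<forall>p\<in>T. exp_holds E p)"

definition Th_R_exp2 :: "eterm fm set" where
  "Th_R_exp2 = {p. free_vars eterm_vars p = {} \<and> exp_holds (\<lambda>x::real. 2 powr x) p}"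

definition exponential_field :: "('a::linordered_field \<Rightarrow> 'a) \<Rightarrow> bool" where
  "exponential_field E \<longleftrightarrow>
     bij_betw E UNIV {0<..} \<and>
     (\<forall>x y. E (x + y) = E x * E y) \<and>
     (\<forall>x y. x \<le> y \<longleftrightarrow> E x \<le> E y)"

text \<open>The inverse of \<open>E\<close>; meaningful only on positive arguments.\<close>

definition log_of :: "('a::linordered_field \<Rightarrow> 'a) \<Rightarrow> 'a \<Rightarrow> 'a" where
  "log_of E = inv_into UNIV E"


section \<open>Integer parts\<close>

definition nonneg_part :: "'a::linordered_field set \<Rightarrow> 'a set" where
  "nonneg_part M = {m \<in> M. 0 \<le> m}"

definition discretely_ordered_subring :: "'a::linordered_field set \<Rightarrow> bool" where
  "discretely_ordered_subring M \<longleftrightarrow>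
     0 \<in> M \<and> 1 \<in> M \<and>
     (\<forall>x\<in>M. \<forall>y\<in>M. x + y \<in> M) \<and>
     (\<forall>x\<in>M. - x \<in> M) \<and>
     (\<forall>x\<in>M. \<forall>y\<in>M. x * y \<in> M) \<and>
     (\<forall>x\<in>M. 0 < x \<longrightarrow> 1 \<le> x)"

definition integer_part :: "'a::linordered_field set \<Rightarrow> bool" where
  "integer_part M \<longleftrightarrow>
     discretely_ordered_subring M \<and> (\<forall>r. \<exists>m\<in>M. m \<le> r \<and> r < m + 1)"

text \<open>The power function \<open>M\<^sup>+ \<times> M\<^sup>+ \<rightarrow> M\<^sup>+\<close> is represented by a total function \<open>pw\<close> on the
  field, of which only the values on \<open>M\<^sup>+ \<times> M\<^sup>+\<close> matter.\<close>

definition xy_integer_part ::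
  "'a::linordered_field set \<Rightarrow> ('a \<Rightarrow> 'a \<Rightarrow> 'a) \<Rightarrow> ('a \<Rightarrow> 'a) \<Rightarrow> bool" where
  "xy_integer_part M pw E \<longleftrightarrow>
     integer_part M \<and>
     (\<forall>n\<in>nonneg_part M. \<forall>m\<in>nonneg_part M. 0 < n \<longrightarrow> pw n m = E (m * log_of E n)) \<and>
     pw 0 0 = 1 \<and>
     (\<forall>m\<in>M. 0 < m \<longrightarrow> pw 0 m = 0)"


section \<open>The language \<open>(0, S, +, \<cdot>, \<le>, x\<^sup>y)\<close> and the theory \<open>IOpen(x\<^sup>y)\<close>\<close>

datatype aterm =
    AVar nat
  | AZero
  | ASuc aterm
  | AAdd aterm aterm
  | AMul aterm aterm
  | APow aterm aterm

record 'a arith_struct =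
  univ :: "'a set"
  zero :: 'a
  suc :: "'a \<Rightarrow> 'a"
  add :: "'a \<Rightarrow> 'a \<Rightarrow> 'a"
  mul :: "'a \<Rightarrow> 'a \<Rightarrow> 'a"
  leq :: "'a \<Rightarrow> 'a \<Rightarrow> bool"
  pow :: "'a \<Rightarrow> 'a \<Rightarrow> 'a"

definition is_structure :: "'a arith_struct \<Rightarrow> bool" where
  "is_structure A \<longleftrightarrow>
     zero A \<in> univ A \<and>
     (\<forall>x\<in>univ A. suc A x \<in> univ A) \<and>
     (\<forall>x\<in>univ A. \<forall>y\<in>univ A. add A x y \<in> univ A) \<and>
     (\<forall>x\<in>univ A. \<forall>y\<in>univ A. mul A x y \<in> univ A) \<and>
     (\<forall>x\<in>univ A. \<forall>y\<in>univ A. pow A x y \<in> univ A)"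

primrec aterm_eval :: "'a arith_struct \<Rightarrow> (nat \<Rightarrow> 'a) \<Rightarrow> aterm \<Rightarrow> 'a" where
  "aterm_eval A v (AVar x) = v x"
| "aterm_eval A v AZero = zero A"
| "aterm_eval A v (ASuc t) = suc A (aterm_eval A v t)"
| "aterm_eval A v (AAdd s t) = add A (aterm_eval A v s) (aterm_eval A v t)"
| "aterm_eval A v (AMul s t) = mul A (aterm_eval A v s) (aterm_eval A v t)"
| "aterm_eval A v (APow s t) = pow A (aterm_eval A v s) (aterm_eval A v t)"

definition arith_model :: "'a arith_struct \<Rightarrow> aterm fm set \<Rightarrow> bool" where
  "arith_model A T \<longleftrightarrow>
     is_structure A \<and> (\<forall>p\<in>T. holds (univ A) (leq A) (aterm_eval A) p)"

primrec aterm_subst :: "nat \<Rightarrow> aterm \<Rightarrow> aterm \<Rightarrow> aterm" where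
  "aterm_subst x s (AVar y) = (if y = x then s else AVar y)"
| "aterm_subst x s AZero = AZero"
| "aterm_subst x s (ASuc t) = ASuc (aterm_subst x s t)"
| "aterm_subst x s (AAdd t u) = AAdd (aterm_subst x s t) (aterm_subst x s u)"
| "aterm_subst x s (AMul t u) = AMul (aterm_subst x s t) (aterm_subst x s u)"
| "aterm_subst x s (APow t u) = APow (aterm_subst x s t) (aterm_subst x s u)"

text \<open>Substitution of \<open>s\<close> for the free occurrences of variable \<open>x\<close>. The quantifier clause does
  not rename bound variables; this is harmless because it is only applied to quantifier-free
  formulas.\<close>

primrec fm_subst :: "nat \<Rightarrow> aterm \<Rightarrow> aterm fm \<Rightarrow> aterm fm" where
  "fm_subst x s (Eq t u) = Eq (aterm_subst x s t) (aterm_subst x s u)"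
| "fm_subst x s (Le t u) = Le (aterm_subst x s t) (aterm_subst x s u)"
| "fm_subst x s (Neg p) = Neg (fm_subst x s p)"
| "fm_subst x s (Conj p q) = Conj (fm_subst x s p) (fm_subst x s q)"
| "fm_subst x s (Forall y p) = Forall y (if y = x then p else fm_subst x s p)"

text \<open>The parameters of the induction formula stay free; \<open>holds\<close> quantifies over them.\<close>

definition induction_axiom :: "nat \<Rightarrow> aterm fm \<Rightarrow> aterm fm" where
  "induction_axiom x p =
     Imp (Conj (fm_subst x AZero p) (Forall x (Imp p (fm_subst x (ASuc (AVar x)) p)))) (Forall x p)"

definition IOpen_xy :: "aterm fm set" where
  "IOpen_xy = (let x = AVar 0; y = AVar 1; r = AVar 2 in
     { Neg (Eq (ASuc x) AZero),
       Imp (Eq (ASuc x) (ASuc y)) (Eq x y),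
       Imp (Neg (Eq x AZero)) (Exists 1 (Eq x (ASuc y))),
       Eq (AAdd x AZero) x,
       Eq (AAdd x (ASuc y)) (ASuc (AAdd x y)),
       Eq (AMul x AZero) AZero,
       Eq (AMul x (ASuc y)) (AAdd (AMul x y) x),
       Iff (Le x y) (Exists 2 (Eq (AAdd r x) y)),
       Eq (APow x AZero) (ASuc AZero),
       Eq (APow y (ASuc x)) (AMul (APow y x) y) })
   \<union> {induction_axiom x p | x p. quantifier_free p}"

definition nonneg_struct ::
  "'a::linordered_field set \<Rightarrow> ('a \<Rightarrow> 'a \<Rightarrow> 'a) \<Rightarrow> 'a arith_struct" where
  "nonneg_struct M pw =
     \<lparr> univ = nonneg_part M, zero = 0, suc = (\<lambda>x. x + 1), add = (+), mul = (*),
       leq = (\<le>), pow = pw \<rparr>"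

end

theory Submission imports Defs begin

text \<open>
  Over the reals, a term \<open>t(x, v)\<close> with parameters \<open>v \<ge> 0\<close> is for \<open>x > 0\<close> either identically
  zero or everywhere positive, so it lives in a differential ring obtained from the polynomials
  in \<open>x\<close> by adjoining reciprocals, logarithms and exponentials one after another. At each stage
  a Rolle argument bounds the number of sign changes in \<open>x\<close> of every element, uniformly in the
  parameters. Hence a quantifier-free formula defines a finite union of intervals in \<open>x\<close>, with a
  bound on their number that does not depend on the parameters. For a fixed bound this is a
  first-order property, which transfers to the exponential field. There, induction in the integer
  part crosses one breakpoint at a time, rounding down with the integer part.
\<close>

section \<open>Piecewise constant functions and the Wronskian\<close>

text \<open>A bound uniform in the parameters is essential: transfer handles one sentence at a time,
  so the number of breakpoints must be a standard number, fixed before the parameters of the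
  exponential field are quantified. The obstacle is \<open>x^y\<close> itself, which jumps where its
  base reaches 0. Terms contain no subtraction, so for nonnegative parameters a base vanishes at all
  positive arguments or at none, and which case occurs depends on the parameters alone; an indicator
  function of the parameters makes that decision. A ring is needed because an atom compares two
  terms, and their difference, which has no such sign dichotomy, is what must be controlled. The
  base 2 plays no special part over the reals, since 2 powr (y * log 2 x) = exp (y * ln x).\<close>

definition const_off :: "real set \<Rightarrow> (real \<Rightarrow> 'b) \<Rightarrow> bool" where
  "const_off Z f \<longleftrightarrow> (\<forall>x y. 0 < x \<longrightarrow> x < y \<longrightarrow> Z \<inter> {x..y} = {} \<longrightarrow> f x = f y)"

text \<open>Breakpoints may carry arbitrary values of their own, since only intervals that miss
  \<open>Z\<close> are constrained. Behaviour at and below 0 is ignored: \<open>x^y\<close> may jump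
  at 0, and the induction treats 0 as its base case.\<close>

definition piecewise_const :: "nat \<Rightarrow> (real \<Rightarrow> 'b) \<Rightarrow> bool" where
  "piecewise_const N f \<longleftrightarrow> (\<exists>Z. finite Z \<and> card Z \<le> N \<and> const_off Z f)"

lemma const_offD:
  "const_off Z f \<Longrightarrow> 0 < x \<Longrightarrow> x \<le> y \<Longrightarrow> Z \<inter> {x..y} = {} \<Longrightarrow> f x = f y"
  unfolding const_off_def by (cases "x = y") auto

lemma const_off_mono: "const_off Z f \<Longrightarrow> Z \<subseteq> Z' \<Longrightarrow> const_off Z' f"
  unfolding const_off_def by blast

lemma piecewise_const_const: "piecewise_const N (\<lambda>x. c)"
  unfolding piecewise_const_def const_off_def by (intro exI[of _ "{}"]) auto

lemma piecewise_const_comp2: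
  assumes "piecewise_const m f" "piecewise_const n g"
    and "\<And>x. 0 < x \<Longrightarrow> k x = h (f x) (g x)"
  shows "piecewise_const (m + n) k"
proof -
  obtain Y Z where YZ: "finite Y" "card Y \<le> m" "const_off Y f"
    "finite Z" "card Z \<le> n" "const_off Z g"
    using assms unfolding piecewise_const_def by blast
  have "card (Y \<union> Z) \<le> m + n"
    using card_Un_le[of Y Z] YZ by linarith
  moreover have "const_off (Y \<union> Z) k"
    unfolding const_off_def
  proof (intro allI impI)
    fix x y :: real assume xy: "0 < x" "x < y" "(Y \<union> Z) \<inter> {x..y} = {}"
    then have "f x = f y" "g x = g y"
      using const_offD[OF YZ(3), of x y] const_offD[OF YZ(6), of x y] by auto
    then show "k x = k y" using assms(3)[of x] assms(3)[of y] xy by simp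
  qed
  ultimately show ?thesis
    unfolding piecewise_const_def using YZ by (intro exI[of _ "Y \<union> Z"]) auto
qed

lemma piecewise_const_cong:
  assumes "piecewise_const n f" "\<And>x. 0 < x \<Longrightarrow> f x = g x"
  shows "piecewise_const n g"
  using assms unfolding piecewise_const_def const_off_def by (metis order_less_trans)

lemma sgn_eq_if_no_zero:
  fixes f :: "real \<Rightarrow> real"
  assumes "x \<le> y" "\<And>t. x \<le> t \<Longrightarrow> t \<le> y \<Longrightarrow> isCont f t"
    and "\<And>t. x \<le> t \<Longrightarrow> t \<le> y \<Longrightarrow> f t \<noteq> 0"
  shows "sgn (f x) = sgn (f y)"
proof (rule ccontr)
  assume "sgn (f x) \<noteq> sgn (f y)"
  moreover have "f x \<noteq> 0" "f y \<noteq> 0" using assms(1,3) by auto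
  ultimately consider "f x \<le> 0" "0 \<le> f y" | "f y \<le> 0" "0 \<le> f x"
    by (auto simp: sgn_real_def split: if_splits)
  then show False
  proof cases
    case 1
    then show ?thesis using IVT[of f x 0 y] assms by blast
  next
    case 2
    then show ?thesis using IVT2[of f y 0 x] assms by blast
  qed
qed

text \<open>Between two points not separated by \<open>Z\<close> the Wronskian has constant sign, so the quotient
  \<open>f / a\<close> is constant or strictly monotone there, and then \<open>f\<close> has at most one further zero.\<close>

lemma piecewise_const_sgn_wronskian:
  fixes f a b f' a' :: "real \<Rightarrow> real"
  assumes f': "\<And>x. 0 < x \<Longrightarrow> (f has_real_derivative f' x) (at x)"
    and a': "\<And>x. 0 < x \<Longrightarrow> (a has_real_derivative a' x) (at x)"
    and pa: "piecewise_const l (\<lambda>x. sgn (a x))"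
    and pw: "piecewise_const m (\<lambda>x. sgn (a x * f' x - a' x * f x))"
    and pb: "piecewise_const n (\<lambda>x. sgn (b x))"
    and ab: "\<And>x. 0 < x \<Longrightarrow> a x = 0 \<Longrightarrow> sgn (f x) = sgn (b x)"
  shows "piecewise_const (2 * (l + m + n) + 1) (\<lambda>x. sgn (f x))"
proof -
  define w where "w x = a x * f' x - a' x * f x" for x
  obtain A W B where sets: "finite A" "card A \<le> l" "const_off A (\<lambda>x. sgn (a x))"
    "finite W" "card W \<le> m" "const_off W (\<lambda>x. sgn (w x))"
    "finite B" "card B \<le> n" "const_off B (\<lambda>x. sgn (b x))"
    using pa pw pb unfolding piecewise_const_def w_def by blast
  define Z where "Z = A \<union> W \<union> B"
  have Z: "finite Z" "card Z \<le> l + m + n"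
    using sets card_Un_le[of "A \<union> W" B] card_Un_le[of A W] by (auto simp: Z_def)
  have cZ: "const_off Z (\<lambda>x. sgn (a x))" "const_off Z (\<lambda>x. sgn (w x))"
    "const_off Z (\<lambda>x. sgn (b x))"
    using sets by (auto simp: Z_def intro: const_off_mono)
  have same: "a t = 0 \<longleftrightarrow> a x = 0" "w t = 0 \<longleftrightarrow> w x = 0"
    if "0 < x" "x \<le> t" "t \<le> y" "Z \<inter> {x..y} = {}" for x y t
  proof -
    have "Z \<inter> {x..t} = {}" using that by auto
    from const_offD[OF cZ(1) that(1,2) this] const_offD[OF cZ(2) that(1,2) this]
    show "a t = 0 \<longleftrightarrow> a x = 0" "w t = 0 \<longleftrightarrow> w x = 0"
      by (metis sgn_0_0)+
  qed
  have quot: "((\<lambda>x. f x / a x) has_real_derivative w x / (a x * a x)) (at x)"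
    if "0 < x" "a x \<noteq> 0" for x
    using DERIV_divide[OF f'[OF that(1)] a'[OF that(1)] that(2)]
    by (simp add: w_def mult.commute)
  \<comment> \<open>Zeros in \<open>Z\<close> are breakpoints already. Where \<open>a\<close> or the
    Wronskian vanishes, \<open>f\<close> may be zero on a whole interval, and such zeros need no
    breakpoint.\<close>
  define X where "X = {x. 0 < x \<and> x \<notin> Z \<and> f x = 0 \<and> a x \<noteq> 0 \<and> w x \<noteq> 0}"
  have sep: "Z \<inter> {x..y} \<noteq> {}" if "x \<in> X" "y \<in> X" "x < y" for x y
  proof
    assume e: "Z \<inter> {x..y} = {}"
    have x: "0 < x" "a x \<noteq> 0" "w x \<noteq> 0" "f x = 0" "f y = 0" using that by (auto simp: X_def)
    have az: "a t \<noteq> 0" "w t \<noteq> 0" "0 < t" if "x \<le> t" "t \<le> y" for t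
      using same[of x t y] that x e by auto
    have "\<exists>t. x < t \<and> t < y \<and> w t / (a t * a t) = 0"
    proof -
      have der: "((\<lambda>x. f x / a x) has_real_derivative w t / (a t * a t)) (at t)"
        if "x \<le> t" "t \<le> y" for t
        using quot az that by blast
      have "continuous_on {x..y} (\<lambda>x. f x / a x)"
        by (intro continuous_at_imp_continuous_on ballI) (auto intro: DERIV_isCont der)
      moreover have "f x / a x = f y / a y" using x by simp
      ultimately obtain t where "x < t" "t < y" "((\<lambda>x. f x / a x) has_real_derivative 0) (at t)"
        using Rolle[OF \<open>x < y\<close>, of "\<lambda>x. f x / a x"] der
        by (metis real_differentiable_def less_imp_le)
      then show ?thesis using der[of t] DERIV_unique by (metis less_imp_le)
    qed
    then show False using az by (metis divide_eq_0_iff less_imp_le mult_eq_0_iff)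
  qed
  \<comment> \<open>\<open>k\<close> numbers the gaps of \<open>Z\<close>. Each gap holds at most
    one point of \<open>X\<close>, so \<open>card X\<close> is at most \<open>card Z + 1\<close>;
    adding \<open>Z\<close> itself gives \<open>2 * (l + m + n) + 1\<close>.\<close>
  define k where "k x = card {z \<in> Z. z < x}" for x
  have kneq: "k x \<noteq> k y" if "x \<in> X" "y \<in> X" "x < y" for x y
  proof
    assume "k x = k y"
    moreover have "{z \<in> Z. z < x} \<subseteq> {z \<in> Z. z < y}" using that by auto
    ultimately have eq: "{z \<in> Z. z < x} = {z \<in> Z. z < y}"
      using Z unfolding k_def by (intro card_subset_eq) auto
    have "Z \<inter> {x..y} \<noteq> {}" using sep that by blast
    then obtain z where "z \<in> Z" "x \<le> z" "z \<le> y" by auto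
    moreover have "z \<noteq> y" using \<open>z \<in> Z\<close> that by (auto simp: X_def)
    ultimately have "z \<in> {z \<in> Z. z < y}" by auto
    then have "z < x" unfolding eq[symmetric] by simp
    then show False using \<open>x \<le> z\<close> by simp
  qed
  have inj: "inj_on k X"
    by (rule inj_onI) (metis kneq linorder_neqE)
  have im: "k ` X \<subseteq> {..card Z}"
    using Z by (auto simp: k_def intro: card_mono)
  have X: "finite X" "card X \<le> card Z + 1"
    using inj_on_finite[OF inj im] card_inj_on_le[OF inj im] by auto
  have "const_off (Z \<union> X) (\<lambda>x. sgn (f x))"
    unfolding const_off_def
  proof (intro allI impI)
    fix x y :: real assume x: "0 < x" and "x < y" and e: "(Z \<union> X) \<inter> {x..y} = {}"
    have eZ: "Z \<inter> {x..y} = {}" using e by auto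
    note same' = same[OF x _ _ eZ]
    \<comment> \<open>On an interval that misses \<open>Z\<close>, each of \<open>a\<close> and
      \<open>w\<close> vanishes everywhere or nowhere. In the first case \<open>f\<close> has the
      sign of \<open>b\<close>, in the second \<open>f / a\<close> is constant, in the third every
      zero of \<open>f\<close> lies in \<open>Z \<union> X\<close>.\<close>
    consider "a x = 0" | "a x \<noteq> 0" "w x = 0" | "a x \<noteq> 0" "w x \<noteq> 0" by blast
    then show "sgn (f x) = sgn (f y)"
    proof cases
      case 1
      then show ?thesis
        using same'(1)[of y] const_offD[OF cZ(3) x _ eZ] ab[of x] ab[of y] x \<open>x < y\<close> by auto
    next
      case 2
      have "((\<lambda>x. f x / a x) has_real_derivative 0) (at t)" if "x \<le> t" "t \<le> y" for t
        using quot[of t] same'[of t] that 2 x by simp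
      then have "f y / a y = f x / a x"
        using DERIV_isconst_end[OF \<open>x < y\<close>, of "\<lambda>x. f x / a x"]
        by (metis DERIV_isCont less_imp_le continuous_at_imp_continuous_on atLeastAtMost_iff)
      moreover have "sgn (a x) = sgn (a y)"
        using const_offD[OF cZ(1) x _ eZ] \<open>x < y\<close> by simp
      moreover have "a y \<noteq> 0" using same'(1)[of y] 2 \<open>x < y\<close> by simp
      ultimately show ?thesis
        using 2 by (metis nonzero_mult_div_cancel_left sgn_mult times_divide_eq_right)
    next
      case 3
      have "f t \<noteq> 0" if "x \<le> t" "t \<le> y" for t
      proof
        assume "f t = 0"
        then have "t \<in> X \<or> t \<in> Z" using 3 same'[of t] that x by (auto simp: X_def)
        then show False using e that by auto
      qed
      moreover have "isCont f t" if "x \<le> t" for t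
        using f'[of t] that x by (auto intro: DERIV_isCont)
      ultimately show ?thesis using \<open>x < y\<close> by (intro sgn_eq_if_no_zero) auto
    qed
  qed
  moreover have "card (Z \<union> X) \<le> 2 * (l + m + n) + 1"
    using card_Un_le[of Z X] X(2) Z(2) unfolding mult_2 by linarith
  ultimately show ?thesis
    unfolding piecewise_const_def using Z X by (intro exI[of _ "Z \<union> X"]) auto
qed

section \<open>Families with uniformly few sign changes\<close>

text \<open>\<open>F p x\<close> is a function of \<open>x > 0\<close> with parameter \<open>p\<close>; its values at \<open>x \<le> 0\<close> are irrelevant.
  The bound \<open>N\<close> must not depend on \<open>p\<close>. The constants include indicator functions of sets of
  parameters, which permits definitions by cases on \<open>p\<close>.\<close>

definition tame :: "('p \<Rightarrow> real \<Rightarrow> real) set \<Rightarrow> bool" where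
  "tame K \<longleftrightarrow>
     (\<forall>c. (\<lambda>p x. c p) \<in> K) \<and>
     (\<forall>F\<in>K. \<forall>G\<in>K. (\<lambda>p x. F p x + G p x) \<in> K) \<and>
     (\<forall>F\<in>K. \<forall>G\<in>K. (\<lambda>p x. F p x * G p x) \<in> K) \<and>
     (\<forall>F\<in>K. \<exists>F'\<in>K. \<forall>p. \<forall>x>0. (F p has_real_derivative F' p x) (at x)) \<and>
     (\<forall>F\<in>K. \<exists>N. \<forall>p. piecewise_const N (\<lambda>x. sgn (F p x)))"

lemma
  assumes "tame K"
  shows tame_const: "(\<lambda>p x. c p) \<in> K"
    and tame_add: "F \<in> K \<Longrightarrow> G \<in> K \<Longrightarrow> (\<lambda>p x. F p x + G p x) \<in> K"
    and tame_mult: "F \<in> K \<Longrightarrow> G \<in> K \<Longrightarrow> (\<lambda>p x. F p x * G p x) \<in> K"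
  using assms unfolding tame_def by auto

lemma tame_minus: "tame K \<Longrightarrow> F \<in> K \<Longrightarrow> (\<lambda>p x. - F p x) \<in> K"
  using tame_mult[of K "\<lambda>p x. -1" F] tame_const[of K "\<lambda>p. -1"] by simp

lemma tame_diff: "tame K \<Longrightarrow> F \<in> K \<Longrightarrow> G \<in> K \<Longrightarrow> (\<lambda>p x. F p x - G p x) \<in> K"
  using tame_add[of K F "\<lambda>p x. - G p x"] tame_minus[of K G] by simp

lemma tame_deriv:
  assumes "tame K" "F \<in> K"
  obtains F' where "F' \<in> K" "\<And>p x. 0 < x \<Longrightarrow> (F p has_real_derivative F' p x) (at x)"
  using assms unfolding tame_def by blast

lemma tame_piecewise_const:
  assumes "tame K" "F \<in> K"
  obtains N where "\<And>p. piecewise_const N (\<lambda>x. sgn (F p x))"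
  using assms unfolding tame_def by blast

lemma tame_constants: "tame (range (\<lambda>c p (x::real). (c p :: real)))"
  unfolding tame_def
proof (intro conjI ballI allI; (elim imageE)?)
  fix F :: "'p \<Rightarrow> real \<Rightarrow> real" and c assume "F = (\<lambda>p x. c p)"
  then show "\<exists>F'\<in>range (\<lambda>c p x. c p). \<forall>p. \<forall>x>0. (F p has_real_derivative F' p x) (at x)"
    by (intro bexI[of _ "\<lambda>p x. 0"]) auto
qed (auto intro: piecewise_const_const)

text \<open>Polynomials in \<open>L\<close> of formal degree below \<open>n\<close>. Coefficients
  need not be unique, and a leading coefficient may vanish at some parameters and points; the formal
  degree is what the later induction runs on.\<close>

primrec polys ::
  "('p \<Rightarrow> real \<Rightarrow> real) set \<Rightarrow> ('p \<Rightarrow> real \<Rightarrow> real) \<Rightarrow> nat \<Rightarrow> ('p \<Rightarrow> real \<Rightarrow> real) set" where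
  "polys K L 0 = {\<lambda>p x. 0}"
| "polys K L (Suc n) = {\<lambda>p x. F p x + a p x * L p x ^ n | F a. F \<in> polys K L n \<and> a \<in> K}"

definition adjoin ::
  "('p \<Rightarrow> real \<Rightarrow> real) set \<Rightarrow> ('p \<Rightarrow> real \<Rightarrow> real) \<Rightarrow> ('p \<Rightarrow> real \<Rightarrow> real) set" where
  "adjoin K L = (\<Union>n. polys K L n)"

lemma polys_SucI:
  "F \<in> polys K L n \<Longrightarrow> a \<in> K \<Longrightarrow> (\<lambda>p x. F p x + a p x * L p x ^ n) \<in> polys K L (Suc n)"
  by auto

lemma polys_SucE:
  assumes "F \<in> polys K L (Suc n)"
  obtains F1 a where "F1 \<in> polys K L n" "a \<in> K" "F = (\<lambda>p x. F1 p x + a p x * L p x ^ n)"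
  using assms by auto

declare polys.simps(2) [simp del]

lemma adjoinI: "F \<in> polys K L n \<Longrightarrow> F \<in> adjoin K L"
  by (auto simp: adjoin_def)

lemma adjoinE:
  assumes "F \<in> adjoin K L"
  obtains n where "F \<in> polys K L n"
  using assms by (auto simp: adjoin_def)

context
  fixes K :: "('p \<Rightarrow> real \<Rightarrow> real) set" and L :: "'p \<Rightarrow> real \<Rightarrow> real"
  assumes K: "tame K"
begin

lemma polys_step: "F \<in> polys K L n \<Longrightarrow> F \<in> polys K L (Suc n)"
  using polys_SucI[of F K L n "\<lambda>p x. 0"] tame_const[OF K, of "\<lambda>p. 0"] by simp

lemma polys_mono: "m \<le> n \<Longrightarrow> F \<in> polys K L m \<Longrightarrow> F \<in> polys K L n"
  by (induction rule: dec_induct) (auto intro: polys_step)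

lemma polys_zero: "(\<lambda>p x. 0) \<in> polys K L n"
  using polys_mono[of 0 n "\<lambda>p x. 0"] by simp

lemma polys_monomial: "a \<in> K \<Longrightarrow> n < m \<Longrightarrow> (\<lambda>p x. a p x * L p x ^ n) \<in> polys K L m"
  using polys_SucI[OF polys_zero, of a n] polys_mono[of "Suc n" m] by simp

lemma polys_add:
  "F \<in> polys K L n \<Longrightarrow> G \<in> polys K L n \<Longrightarrow> (\<lambda>p x. F p x + G p x) \<in> polys K L n"
proof (induction n arbitrary: F G)
  case (Suc n)
  from Suc.prems obtain F1 a G1 b where
    F: "F1 \<in> polys K L n" "a \<in> K" "F = (\<lambda>p x. F1 p x + a p x * L p x ^ n)" and
    G: "G1 \<in> polys K L n" "b \<in> K" "G = (\<lambda>p x. G1 p x + b p x * L p x ^ n)" by (blast elim: polys_SucE)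
  have "(\<lambda>p x. (F1 p x + G1 p x) + (a p x + b p x) * L p x ^ n) \<in> polys K L (Suc n)"
    using F G by (intro polys_SucI Suc.IH tame_add[OF K])
  then show ?case by (simp add: F G algebra_simps)
qed simp

lemma polys_scale:
  "F \<in> polys K L n \<Longrightarrow> b \<in> K \<Longrightarrow> (\<lambda>p x. b p x * F p x) \<in> polys K L n"
proof (induction n arbitrary: F)
  case (Suc n)
  from Suc.prems obtain F1 a where
    F: "F1 \<in> polys K L n" "a \<in> K" "F = (\<lambda>p x. F1 p x + a p x * L p x ^ n)" by (blast elim: polys_SucE)
  have "(\<lambda>p x. b p x * F1 p x + (b p x * a p x) * L p x ^ n) \<in> polys K L (Suc n)"
    using F Suc.prems by (intro polys_SucI Suc.IH tame_mult[OF K])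
  then show ?case by (simp add: F algebra_simps)
qed simp

lemma polys_diff:
  assumes "F \<in> polys K L n" "G \<in> polys K L n"
  shows "(\<lambda>p x. F p x - G p x) \<in> polys K L n"
  using polys_add[OF assms(1) polys_scale[OF assms(2) tame_const[OF K, of "\<lambda>p. -1"]]] by simp

lemma polys_mult_L:
  "F \<in> polys K L n \<Longrightarrow> (\<lambda>p x. F p x * L p x) \<in> polys K L (Suc n)"
proof (induction n arbitrary: F)
  case 0
  then show ?case using polys_zero[where n = "Suc 0"] by simp
next
  case (Suc n)
  from Suc.prems obtain F1 a where
    F: "F1 \<in> polys K L n" "a \<in> K" "F = (\<lambda>p x. F1 p x + a p x * L p x ^ n)" by (blast elim: polys_SucE)
  have "(\<lambda>p x. F1 p x * L p x + a p x * L p x ^ Suc n) \<in> polys K L (Suc (Suc n))"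
    using F by (intro polys_SucI Suc.IH)
  then show ?case by (simp add: F algebra_simps)
qed

lemma polys_mult_L_power:
  "F \<in> polys K L n \<Longrightarrow> (\<lambda>p x. F p x * L p x ^ m) \<in> polys K L (n + m)"
proof (induction m)
  case (Suc m)
  from polys_mult_L[OF Suc.IH[OF Suc.prems]] show ?case by (simp add: mult_ac)
qed simp

lemma polys_mult:
  "F \<in> polys K L n \<Longrightarrow> G \<in> polys K L m \<Longrightarrow> (\<lambda>p x. F p x * G p x) \<in> polys K L (n + m)"
proof (induction m arbitrary: G)
  case (Suc m)
  from Suc.prems obtain G1 a where
    G: "G1 \<in> polys K L m" "a \<in> K" "G = (\<lambda>p x. G1 p x + a p x * L p x ^ m)"
    by (blast elim: polys_SucE)
  have "(\<lambda>p x. F p x * G1 p x + a p x * F p x * L p x ^ m) \<in> polys K L (n + m)"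
    using G Suc.prems by (intro polys_add Suc.IH polys_mult_L_power polys_scale)
  from polys_step[OF this] show ?case by (simp add: G distrib_left mult.assoc mult.left_commute)
qed (use polys_zero in simp)

lemma subset_adjoin: "K \<subseteq> adjoin K L"
  using polys_monomial[where n = 0 and m = "Suc 0"] by (auto intro!: adjoinI[where n = "Suc 0"])

lemma self_adjoin: "L \<in> adjoin K L"
  using polys_monomial[OF tame_const[OF K, of "\<lambda>p. 1"], where n = "Suc 0" and m = 2]
  by (auto intro!: adjoinI[where n = 2])

lemma adjoin_add:
  assumes "F \<in> adjoin K L" "G \<in> adjoin K L"
  shows "(\<lambda>p x. F p x + G p x) \<in> adjoin K L"
proof -
  obtain m n where "F \<in> polys K L m" "G \<in> polys K L n" using assms by (elim adjoinE)
  then have "F \<in> polys K L (max m n)" "G \<in> polys K L (max m n)"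
    by (auto intro: polys_mono[rotated])
  then show ?thesis by (blast intro: polys_add adjoinI)
qed

lemma adjoin_mult:
  assumes "F \<in> adjoin K L" "G \<in> adjoin K L"
  shows "(\<lambda>p x. F p x * G p x) \<in> adjoin K L"
  using assms by (blast intro: polys_mult adjoinI elim: adjoinE)

lemma tame_adjoinI:
  assumes "\<And>F. F \<in> adjoin K L \<Longrightarrow>
      \<exists>F'\<in>adjoin K L. \<forall>p. \<forall>x>0. (F p has_real_derivative F' p x) (at x)"
    and "\<And>F. F \<in> adjoin K L \<Longrightarrow> \<exists>N. \<forall>p. piecewise_const N (\<lambda>x. sgn (F p x))"
  shows "tame (adjoin K L)"
  unfolding tame_def
  using assms adjoin_add adjoin_mult subset_adjoin tame_const[OF K] by blast

text \<open>The degree in \<open>L\<close> may grow under differentiation, which does no harm to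
  membership in \<open>adjoin K L\<close>. Reciprocals need this, their derivative being quadratic
  in \<open>L\<close>.\<close>

lemma adjoin_deriv:
  assumes "L' \<in> adjoin K L"
    and "\<And>p x. 0 < x \<Longrightarrow> (L p has_real_derivative L' p x) (at x)"
    and "F \<in> adjoin K L"
  shows "\<exists>F'\<in>adjoin K L. \<forall>p. \<forall>x>0. (F p has_real_derivative F' p x) (at x)"
proof -
  have mon: "\<exists>D\<in>adjoin K L. \<forall>p. \<forall>x>0. ((\<lambda>x. L p x ^ n) has_real_derivative D p x) (at x)" for n
  proof (induction n)
    case 0
    show ?case using subset_adjoin tame_const[OF K, of "\<lambda>p. 0"]
      by (intro bexI[of _ "\<lambda>p x. 0"]) auto
  next
    case (Suc n)
    then obtain D where D: "D \<in> adjoin K L"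
      "\<And>p x. 0 < x \<Longrightarrow> ((\<lambda>x. L p x ^ n) has_real_derivative D p x) (at x)" by blast
    have pow: "(\<lambda>p x. L p x ^ n) \<in> adjoin K L"
      using polys_monomial[OF tame_const[OF K, of "\<lambda>p. 1"], where n = n and m = "Suc n"] by (auto intro!: adjoinI)
    have "(\<lambda>p x. L' p x * L p x ^ n + D p x * L p x) \<in> adjoin K L"
      by (intro adjoin_add adjoin_mult pow D self_adjoin assms)
    moreover have "((\<lambda>x. L p x ^ Suc n) has_real_derivative L' p x * L p x ^ n + D p x * L p x) (at x)"
      if "0 < x" for p x
      using DERIV_mult[OF assms(2)[OF that] D(2)[OF that]] by simp
    ultimately show ?case by (intro bexI[of _ "\<lambda>p x. L' p x * L p x ^ n + D p x * L p x"]) auto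
  qed
  have "\<exists>F'\<in>adjoin K L. \<forall>p. \<forall>x>0. (F p has_real_derivative F' p x) (at x)"
    if "F \<in> polys K L n" for n F
    using that
  proof (induction n arbitrary: F)
    case 0
    then show ?case using subset_adjoin tame_const[OF K, of "\<lambda>p. 0"]
      by (intro bexI[of _ "\<lambda>p x. 0"]) auto
  next
    case (Suc n)
    from Suc.prems obtain F1 a where
      F: "F1 \<in> polys K L n" "a \<in> K" "F = (\<lambda>p x. F1 p x + a p x * L p x ^ n)" by (blast elim: polys_SucE)
    obtain a' where a': "a' \<in> K" "\<And>p x. 0 < x \<Longrightarrow> (a p has_real_derivative a' p x) (at x)"
      using tame_deriv[OF K F(2)] by blast
    obtain F1' where F1': "F1' \<in> adjoin K L"
      "\<And>p x. 0 < x \<Longrightarrow> (F1 p has_real_derivative F1' p x) (at x)"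
      using Suc.IH[OF F(1)] by blast
    obtain D where D: "D \<in> adjoin K L"
      "\<And>p x. 0 < x \<Longrightarrow> ((\<lambda>x. L p x ^ n) has_real_derivative D p x) (at x)" using mon by blast
    have pow: "(\<lambda>p x. L p x ^ n) \<in> adjoin K L"
      using polys_monomial[OF tame_const[OF K, of "\<lambda>p. 1"], where n = n and m = "Suc n"] by (auto intro!: adjoinI)
    have "(\<lambda>p x. F1' p x + (a' p x * L p x ^ n + D p x * a p x)) \<in> adjoin K L"
      using subset_adjoin a' F by (intro adjoin_add adjoin_mult pow D F1') auto
    moreover have "(F p has_real_derivative F1' p x + (a' p x * L p x ^ n + D p x * a p x)) (at x)"
      if "0 < x" for p x
      unfolding F(3) using that by (intro DERIV_add DERIV_mult F1' a' D)
    ultimately show ?case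
      by (intro bexI[of _ "\<lambda>p x. F1' p x + (a' p x * L p x ^ n + D p x * a p x)"]) auto
  qed
  then show ?thesis using assms(3) by (blast elim: adjoinE)
qed

end

text \<open>For \<open>L' = h + g * L\<close> differentiation does not raise the degree in
  \<open>L\<close>: the top coefficient becomes \<open>a' + n * g * a\<close>, and \<open>h\<close>
  feeds the next lower power. At \<open>n = 0\<close> the truncated exponent \<open>n - 1\<close> is
  harmless because its coefficient is 0.\<close>

lemma DERIV_add_mult_power_affine:
  fixes F a L :: "real \<Rightarrow> real"
  assumes L: "(L has_real_derivative h + g * L x) (at x)"
    and a: "(a has_real_derivative a') (at x)"
    and F: "(F has_real_derivative F') (at x)"
  shows "((\<lambda>x. F x + a x * L x ^ n) has_real_derivative
      F' + (a' + real n * g * a x) * L x ^ n + real n * a x * h * L x ^ (n - 1)) (at x)"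
proof -
  have "((\<lambda>x. L x ^ n) has_real_derivative real n * (h + g * L x) * L x ^ (n - 1)) (at x)"
    using DERIV_power[OF L, of n] by (simp add: mult_ac)
  from DERIV_add[OF F DERIV_mult[OF a this]]
  show ?thesis by (cases n) (simp_all add: algebra_simps)
qed

text \<open>The term fed by \<open>h\<close> has degree below \<open>n\<close>; this separate fact
  later places the reduced Wronskian in \<open>polys K L n\<close>.\<close>

lemma polys_deriv_mem:
  assumes K: "tame K" and gh: "g \<in> K" "h \<in> K" and a: "a \<in> K" "a' \<in> K"
    and F': "F' \<in> polys K L n"
  shows "(\<lambda>p x. real n * a p x * h p x * L p x ^ (n - 1)) \<in> polys K L n"
    and "(\<lambda>p x. F' p x + (a' p x + real n * g p x * a p x) * L p x ^ n
        + real n * a p x * h p x * L p x ^ (n - 1)) \<in> polys K L (Suc n)"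
proof -
  show low: "(\<lambda>p x. real n * a p x * h p x * L p x ^ (n - 1)) \<in> polys K L n"
  proof (cases n)
    case (Suc m)
    then show ?thesis using gh a
      by (auto intro!: polys_monomial[OF K] tame_mult[OF K] tame_const[OF K])
  qed simp
  have "(\<lambda>p x. (F' p x + real n * a p x * h p x * L p x ^ (n - 1))
      + (a' p x + real n * g p x * a p x) * L p x ^ n) \<in> polys K L (Suc n)"
    using gh a F' low
    by (intro polys_SucI polys_add[OF K] tame_add[OF K] tame_mult[OF K] tame_const[OF K])
  then show "(\<lambda>p x. F' p x + (a' p x + real n * g p x * a p x) * L p x ^ n
        + real n * a p x * h p x * L p x ^ (n - 1)) \<in> polys K L (Suc n)"
    by (simp add: add.assoc add.commute add.left_commute)
qed

text \<open>The integrating factor \<open>\<mu>\<close> makes the Wronskian of \<open>F = R + a L\<^sup>n\<close> with \<open>a \<mu>\<^sup>n\<close> lose its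
  term of degree \<open>n\<close> in \<open>L\<close>, so that the induction hypothesis on \<open>n\<close> applies to it.\<close>

lemma polys_tame_affine:
  assumes K: "tame K" and gh: "g \<in> K" "h \<in> K"
    and L: "\<And>p x. 0 < x \<Longrightarrow> (L p has_real_derivative h p x + g p x * L p x) (at x)"
    and mu: "\<And>p x. 0 < x \<Longrightarrow> 0 < \<mu> p x"
      "\<And>p x. 0 < x \<Longrightarrow> (\<mu> p has_real_derivative g p x * \<mu> p x) (at x)"
  shows "F \<in> polys K L n \<Longrightarrow>
    (\<exists>F'\<in>polys K L n. \<forall>p. \<forall>x>0. (F p has_real_derivative F' p x) (at x)) \<and>
    (\<exists>N. \<forall>p. piecewise_const N (\<lambda>x. sgn (F p x)))"
proof (induction n arbitrary: F)
  case 0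
  then show ?case by (auto intro: piecewise_const_const)
next
  case (Suc n)
  from Suc.prems obtain R a where
    F: "R \<in> polys K L n" "a \<in> K" "F = (\<lambda>p x. R p x + a p x * L p x ^ n)"
    by (elim polys_SucE)
  obtain a' where a': "a' \<in> K" "\<And>p x. 0 < x \<Longrightarrow> (a p has_real_derivative a' p x) (at x)"
    using tame_deriv[OF K F(2)] by blast
  obtain R' where R': "R' \<in> polys K L n"
    "\<And>p x. 0 < x \<Longrightarrow> (R p has_real_derivative R' p x) (at x)"
    using Suc.IH[OF F(1)] by blast
  define F' where "F' p x = R' p x + (a' p x + real n * g p x * a p x) * L p x ^ n
        + real n * a p x * h p x * L p x ^ (n - 1)" for p x
  have F': "(F p has_real_derivative F' p x) (at x)" if "0 < x" for p x
    unfolding F(3) F'_def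
    by (rule DERIV_add_mult_power_affine[OF L[OF that] a'(2)[OF that] R'(2)[OF that]])
  have F'_mem: "F' \<in> polys K L (Suc n)"
    unfolding F'_def by (rule polys_deriv_mem(2)[OF K gh F(2) a'(1) R'(1)])
  \<comment> \<open>\<open>A'\<close> has the same coefficient as the power \<open>L ^ n\<close> in
    \<open>F'\<close>, so the top terms of \<open>A * F' - A' * F\<close> cancel.
    \<open>\<mu>\<close> need not belong to \<open>K\<close>: being positive, it leaves the sign of
    \<open>a\<close> unchanged.\<close>
  define A where "A p x = a p x * \<mu> p x ^ n" for p x
  define A' where "A' p x = (a' p x + real n * g p x * a p x) * \<mu> p x ^ n" for p x
  have A': "(A p has_real_derivative A' p x) (at x)" if "0 < x" for p x
  proof -
    have "((\<lambda>x. \<mu> p x ^ n) has_real_derivative real n * g p x * \<mu> p x ^ n) (at x)"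
      using DERIV_power[OF mu(2)[OF that, of p], of n] by (cases n) (simp_all add: mult_ac)
    from DERIV_mult[OF a'(2)[OF that] this] show ?thesis
      unfolding A_def[abs_def] A'_def by (simp add: algebra_simps)
  qed
  \<comment> \<open>The Wronskian divided by \<open>\<mu> ^ n\<close>, without the cancelled terms.
    Its membership needs the degree bound on \<open>R'\<close>, which is why derivatives and signs
    are treated in one induction.\<close>
  define w where "w p x = a p x * (R' p x + real n * a p x * h p x * L p x ^ (n - 1))
      - (a' p x + real n * g p x * a p x) * R p x" for p x
  have "w \<in> polys K L n"
    unfolding w_def
  proof (rule polys_diff[OF K])
    have "(\<lambda>p x. a' p x + real n * g p x * a p x) \<in> K"
      using a' F gh by (intro tame_add[OF K] tame_mult[OF K] tame_const[OF K])
    then show "(\<lambda>p x. (a' p x + real n * g p x * a p x) * R p x) \<in> polys K L n"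
      by (rule polys_scale[OF K F(1)])
    show "(\<lambda>p x. a p x * (R' p x + real n * a p x * h p x * L p x ^ (n - 1))) \<in> polys K L n"
      by (rule polys_scale[OF K
            polys_add[OF K R'(1) polys_deriv_mem(1)[OF K gh F(2) a'(1) R'(1)]] F(2)])
  qed
  then obtain m where m: "\<And>p. piecewise_const m (\<lambda>x. sgn (w p x))"
    using Suc.IH by blast
  have W: "A p x * F' p x - A' p x * F p x = w p x * \<mu> p x ^ n" for p x
    unfolding A_def F'_def A'_def F(3) w_def by (simp add: algebra_simps)
  obtain l where l: "\<And>p. piecewise_const l (\<lambda>x. sgn (a p x))"
    using tame_piecewise_const[OF K F(2)] by blast
  obtain k where k: "\<And>p. piecewise_const k (\<lambda>x. sgn (R p x))"
    using Suc.IH[OF F(1)] by blast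
  have "piecewise_const (2 * (l + m + k) + 1) (\<lambda>x. sgn (F p x))" for p
  proof (rule piecewise_const_sgn_wronskian[OF F' A'])
    show "piecewise_const l (\<lambda>x. sgn (A p x))"
      by (rule piecewise_const_cong[OF l[of p]]) (simp add: A_def sgn_mult mu(1))
    show "piecewise_const m (\<lambda>x. sgn (A p x * F' p x - A' p x * F p x))"
      unfolding W by (rule piecewise_const_cong[OF m[of p]]) (simp add: sgn_mult mu(1))
    show "sgn (F p x) = sgn (R p x)" if "0 < x" "A p x = 0" for x
      using that mu(1)[of x p] by (simp add: A_def F(3))
  qed (use k in auto)
  then show ?case using F' F'_mem by blast
qed

text \<open>Covers exponentials (\<open>h = 0\<close>, \<open>\<mu> = L\<close>) and antiderivatives
  (\<open>g = 0\<close>, \<open>\<mu> = 1\<close>). Reciprocals of \<open>s\<close> are not covered,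
  as \<open>g = - s' / s\<close> need not lie in \<open>K\<close>.\<close>

lemma tame_adjoin_affine:
  assumes "tame K" "g \<in> K" "h \<in> K"
    and "\<And>p x. 0 < x \<Longrightarrow> (L p has_real_derivative h p x + g p x * L p x) (at x)"
    and "\<And>p x. 0 < x \<Longrightarrow> 0 < \<mu> p x"
    and "\<And>p x. 0 < x \<Longrightarrow> (\<mu> p has_real_derivative g p x * \<mu> p x) (at x)"
  shows "tame (adjoin K L)"
proof (rule tame_adjoinI[OF assms(1)])
  fix F assume "F \<in> adjoin K L"
  then obtain n where F: "F \<in> polys K L n" by (elim adjoinE)
  have affine: "(\<exists>F'\<in>polys K L n. \<forall>p. \<forall>x>0. (F p has_real_derivative F' p x) (at x)) \<and>
      (\<exists>N. \<forall>p. piecewise_const N (\<lambda>x. sgn (F p x)))"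
    by (rule polys_tame_affine[OF assms F])
  show "\<exists>F'\<in>adjoin K L. \<forall>p. \<forall>x>0. (F p has_real_derivative F' p x) (at x)"
    using affine by (blast intro: adjoinI)
  show "\<exists>N. \<forall>p. piecewise_const N (\<lambda>x. sgn (F p x))"
    using affine by blast
qed

section \<open>Adjoining exponentials, antiderivatives and reciprocals\<close>

lemma tame_adjoin_exp:
  assumes "tame K" "F \<in> K"
  shows "tame (adjoin K (\<lambda>p x. exp (F p x)))"
proof -
  obtain F' where F': "F' \<in> K" "\<And>p x. 0 < x \<Longrightarrow> (F p has_real_derivative F' p x) (at x)"
    using tame_deriv[OF assms] by blast
  have "((\<lambda>x. exp (F p x)) has_real_derivative F' p x * exp (F p x)) (at x)" if "0 < x" for p x
    using DERIV_fun_exp[OF F'(2)[OF that]] by (simp add: mult.commute)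
  then show ?thesis
    using tame_const[OF assms(1), of "\<lambda>p. 0"] F'(1)
    by (intro tame_adjoin_affine[OF assms(1), of F' "\<lambda>p x. 0" _ "\<lambda>p x. exp (F p x)"]) auto
qed

lemma tame_adjoin_antiderivative:
  assumes "tame K" "h \<in> K" "\<And>p x. 0 < x \<Longrightarrow> (L p has_real_derivative h p x) (at x)"
  shows "tame (adjoin K L)"
  using tame_const[OF assms(1), of "\<lambda>p. 0"] assms
  by (intro tame_adjoin_affine[OF assms(1), of "\<lambda>p x. 0" h _ "\<lambda>p x. 1"]) auto

lemma tame_adjoin_inverse:
  assumes K: "tame K" and s: "s \<in> K" "\<And>p x. 0 < x \<Longrightarrow> 0 < s p x"
  shows "tame (adjoin K (\<lambda>p x. inverse (s p x)))" (is "tame (adjoin K ?L)")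
proof (rule tame_adjoinI[OF K])
  obtain s' where s': "s' \<in> K" "\<And>p x. 0 < x \<Longrightarrow> (s p has_real_derivative s' p x) (at x)"
    using tame_deriv[OF K s(1)] by blast
  fix F assume F: "F \<in> adjoin K ?L"
  have mem: "(\<lambda>p x. (- s' p x) * ?L p x * ?L p x) \<in> adjoin K ?L"
    using subset_adjoin[OF K] tame_minus[OF K s'(1)]
    by (intro adjoin_mult[OF K] self_adjoin[OF K]) auto
  have deriv: "(?L p has_real_derivative (- s' p x) * ?L p x * ?L p x) (at x)" if "0 < x" for p x
    using DERIV_inverse_fun[OF s'(2)[OF that]] s(2)[OF that, of p]
    by (simp add: power2_eq_square mult_ac)
  show "\<exists>F'\<in>adjoin K ?L. \<forall>p. \<forall>x>0. (F p has_real_derivative F' p x) (at x)"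
    by (rule adjoin_deriv[OF K mem deriv F])
  \<comment> \<open>Clearing denominators puts the function back into \<open>K\<close>, and the
    positive factor keeps its sign. The exponent \<open>n\<close> exceeds the formal degree, hence
    the surplus factor in \<open>a * s\<close> below.\<close>
  have clear: "\<exists>G\<in>K. \<forall>p. \<forall>x>0. s p x ^ n * F p x = G p x" if "F \<in> polys K ?L n" for n F
    using that
  proof (induction n arbitrary: F)
    case 0
    then show ?case using tame_const[OF K, of "\<lambda>p. 0"] by (intro bexI[of _ "\<lambda>p x. 0"]) auto
  next
    case (Suc n)
    from Suc.prems obtain R a where
      F: "R \<in> polys K ?L n" "a \<in> K" "F = (\<lambda>p x. R p x + a p x * ?L p x ^ n)"
      by (elim polys_SucE)
    obtain G where G: "G \<in> K" "\<And>p x. 0 < x \<Longrightarrow> s p x ^ n * R p x = G p x"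
      using Suc.IH[OF F(1)] by blast
    have "s p x ^ Suc n * F p x = s p x * G p x + a p x * s p x" if "0 < x" for p x
      unfolding F(3) G(2)[OF that, symmetric] using s(2)[OF that, of p]
      by (simp add: field_simps)
    moreover have "(\<lambda>p x. s p x * G p x + a p x * s p x) \<in> K"
      by (intro tame_add[OF K] tame_mult[OF K] s G F)
    ultimately show ?case by (intro bexI[of _ "\<lambda>p x. s p x * G p x + a p x * s p x"]) auto
  qed
  obtain n where "F \<in> polys K ?L n" using F by (elim adjoinE)
  then obtain G where G: "G \<in> K" "\<And>p x. 0 < x \<Longrightarrow> s p x ^ n * F p x = G p x"
    using clear by blast
  obtain N where N: "\<And>p. piecewise_const N (\<lambda>x. sgn (G p x))"
    using tame_piecewise_const[OF K G(1)] by blast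
  have "piecewise_const N (\<lambda>x. sgn (F p x))" for p
    by (rule piecewise_const_cong[OF N[of p]]) (simp add: G(2)[symmetric] sgn_mult s(2))
  then show "\<exists>N. \<forall>p. piecewise_const N (\<lambda>x. sgn (F p x))" by blast
qed

section \<open>Expressing arithmetic formulas in exponential fields\<close>

primrec aterm_vars :: "aterm \<Rightarrow> nat set" where
  "aterm_vars (AVar x) = {x}"
| "aterm_vars AZero = {}"
| "aterm_vars (ASuc t) = aterm_vars t"
| "aterm_vars (AAdd s t) = aterm_vars s \<union> aterm_vars t"
| "aterm_vars (AMul s t) = aterm_vars s \<union> aterm_vars t"
| "aterm_vars (APow s t) = aterm_vars s \<union> aterm_vars t"

lemma finite_aterm_vars: "finite (aterm_vars t)"
  by (induction t) auto

lemma finite_eterm_vars: "finite (eterm_vars t)"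
  by (induction t) auto

lemma finite_free_vars: "(\<And>t. finite (tv t)) \<Longrightarrow> finite (free_vars tv p)"
  by (induction p) auto

lemma aterm_eval_cong:
  "(\<And>x. x \<in> aterm_vars t \<Longrightarrow> v x = w x) \<Longrightarrow> aterm_eval A v t = aterm_eval A w t"
  by (induction t) auto

lemma sat_cong_quantifier_free:
  "quantifier_free p \<Longrightarrow> (\<And>x. x \<in> free_vars aterm_vars p \<Longrightarrow> v x = w x) \<Longrightarrow>
    sat U le (aterm_eval A) p v \<longleftrightarrow> sat U le (aterm_eval A) p w"
proof (induction p)
  case (Eq s t)
  then show ?case using aterm_eval_cong[of s v w A] aterm_eval_cong[of t v w A] by simp
next
  case (Le s t)
  then show ?case using aterm_eval_cong[of s v w A] aterm_eval_cong[of t v w A] by simp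
qed auto

lemma aterm_eval_subst:
  "aterm_eval A v (aterm_subst x s t) = aterm_eval A (v(x := aterm_eval A v s)) t"
  by (induction t) auto

lemma sat_subst_quantifier_free:
  "quantifier_free p \<Longrightarrow>
    sat U le (aterm_eval A) (fm_subst x s p) v \<longleftrightarrow>
    sat U le (aterm_eval A) p (v(x := aterm_eval A v s))"
  by (induction p) (auto simp: aterm_eval_subst)

text \<open>The power function that \<open>E\<close> induces on the whole field. On a non-positive base it is given
  the values of \<open>0\<^sup>y\<close>.\<close>

definition field_pow :: "('a::linordered_field \<Rightarrow> 'a) \<Rightarrow> 'a \<Rightarrow> 'a \<Rightarrow> 'a" where
  "field_pow E x y = (if 0 < x then E (y * log_of E x) else if y = 0 then 1 else 0)"

definition field_struct :: "('a::linordered_field \<Rightarrow> 'a) \<Rightarrow> 'a arith_struct" where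
  "field_struct E =
     \<lparr> univ = UNIV, zero = 0, suc = (\<lambda>x. x + 1), add = (+), mul = (*), leq = (\<le>),
       pow = field_pow E \<rparr>"

lemma field_struct_simps [simp]:
  "zero (field_struct E) = 0" "suc (field_struct E) x = x + 1" "add (field_struct E) = (+)"
  "mul (field_struct E) = (*)" "pow (field_struct E) = field_pow E"
  by (simp_all add: field_struct_def)

lemma E_log_of:
  assumes "exponential_field E" "0 < x"
  shows "E (log_of E x) = x"
  using assms unfolding exponential_field_def bij_betw_def log_of_def
  by (auto intro: f_inv_into_f)

lemma log_of_E:
  assumes "exponential_field E"
  shows "log_of E (E x) = x"
  using assms unfolding exponential_field_def bij_betw_def log_of_def
  by (auto intro: inv_into_f_f)

lemma E_pos: "exponential_field E \<Longrightarrow> 0 < E x"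
  unfolding exponential_field_def bij_betw_def by auto

text \<open>\<open>value_fm t k n\<close> says that \<open>k\<close> is the value of \<open>t\<close>; it binds only variables \<open>\<ge> n\<close>.\<close>

primrec value_fm :: "aterm \<Rightarrow> nat \<Rightarrow> nat \<Rightarrow> eterm fm" where
  "value_fm (AVar x) k n = Eq (EVar k) (EVar x)"
| "value_fm AZero k n = Eq (EVar k) EZero"
| "value_fm (ASuc t) k n =
     Exists n (Conj (value_fm t n (n + 1)) (Eq (EVar k) (EAdd (EVar n) EOne)))"
| "value_fm (AAdd s t) k n =
     Exists n (Exists (n + 1) (Conj (value_fm s n (n + 2)) (Conj (value_fm t (n + 1) (n + 2))
       (Eq (EVar k) (EAdd (EVar n) (EVar (n + 1)))))))"
| "value_fm (AMul s t) k n =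
     Exists n (Exists (n + 1) (Conj (value_fm s n (n + 2)) (Conj (value_fm t (n + 1) (n + 2))
       (Eq (EVar k) (EMul (EVar n) (EVar (n + 1)))))))"
| "value_fm (APow s t) k n =
     Exists n (Exists (n + 1) (Conj (value_fm s n (n + 2)) (Conj (value_fm t (n + 1) (n + 2))
       (Conj
         (Imp (Neg (Le (EVar n) EZero))
           (Exists (n + 2) (Conj (Eq (EExp (EVar (n + 2))) (EVar n))
             (Eq (EVar k) (EExp (EMul (EVar (n + 1)) (EVar (n + 2))))))))
         (Imp (Le (EVar n) EZero)
           (Conj (Imp (Eq (EVar (n + 1)) EZero) (Eq (EVar k) EOne))
             (Imp (Neg (Eq (EVar (n + 1)) EZero)) (Eq (EVar k) EZero))))))))"

lemma aterm_eval_upd: "\<forall>x\<in>aterm_vars t. x < n \<Longrightarrow> n \<le> m \<Longrightarrow>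
   aterm_eval A (v(m := a)) t = aterm_eval A v t"
  by (rule aterm_eval_cong) auto

lemma sat_value_fm:
  assumes "exponential_field E"
  shows "\<forall>x\<in>aterm_vars t. x < n \<Longrightarrow> k < n \<Longrightarrow>
    sat UNIV (\<le>) (eterm_eval E) (value_fm t k n) v \<longleftrightarrow> v k = aterm_eval (field_struct E) v t"
proof (induction t arbitrary: k n v)
  case (ASuc t)
  have b: "\<forall>x\<in>aterm_vars t. x < n + 1" using ASuc.prems by auto
  have "sat UNIV (\<le>) (eterm_eval E) (value_fm t n (n + 1)) w \<longleftrightarrow>
      w n = aterm_eval (field_struct E) w t" for w
    using ASuc.IH[OF b] by simp
  then show ?case using ASuc.prems by (simp add: aterm_eval_upd[of t n n])
next
  case (AAdd s t)
  have b: "\<forall>x\<in>aterm_vars s. x < n + 2" "\<forall>x\<in>aterm_vars t. x < n + 2" using AAdd.prems by (auto intro: less_SucI)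
  show ?case using AAdd.prems AAdd.IH(1)[OF b(1)] AAdd.IH(2)[OF b(2)] by (simp add: aterm_eval_upd[where n = n] fun_upd_same fun_upd_other
      del: fun_upd_apply)
next
  case (AMul s t)
  have b: "\<forall>x\<in>aterm_vars s. x < n + 2" "\<forall>x\<in>aterm_vars t. x < n + 2" using AMul.prems by (auto intro: less_SucI)
  show ?case using AMul.prems AMul.IH(1)[OF b(1)] AMul.IH(2)[OF b(2)] by (simp add: aterm_eval_upd[where n = n] fun_upd_same fun_upd_other
      del: fun_upd_apply)
next
  case (APow s t)
  have b: "\<forall>x\<in>aterm_vars s. x < n + 2" "\<forall>x\<in>aterm_vars t. x < n + 2" using APow.prems by (auto intro: less_SucI)
  \<comment> \<open>The language has no logarithm; the unique preimage under \<open>E\<close> stands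
    for it.\<close>
  have log: "(\<exists>l. E l = x \<and> z = E (y * l)) \<longleftrightarrow> z = E (y * log_of E x)" if "0 < x" for x y z
    using E_log_of[OF assms that] log_of_E[OF assms] by metis
  show ?case using APow.prems APow.IH(1)[OF b(1)] APow.IH(2)[OF b(2)]
    by (auto simp: aterm_eval_upd[where n = n] field_pow_def log not_le fun_upd_same fun_upd_other
      simp del: fun_upd_apply)
qed auto

text \<open>\<open>n\<close> is meant to lie above all variables of the formula, so that
  \<open>n\<close> and \<open>n + 1\<close> are fresh names for values of terms; powers have no
  counterpart among the \<open>eterm\<close>s.\<close>

primrec translate :: "nat \<Rightarrow> aterm fm \<Rightarrow> eterm fm" where
  "translate n (Eq s t) =
     Exists n (Conj (value_fm s n (n + 1)) (value_fm t n (n + 1)))"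
| "translate n (Le s t) =
     Exists n (Exists (n + 1) (Conj (value_fm s n (n + 2)) (Conj (value_fm t (n + 1) (n + 2))
       (Le (EVar n) (EVar (n + 1))))))"
| "translate n (Neg p) = Neg (translate n p)"
| "translate n (Conj p q) = Conj (translate n p) (translate n q)"
| "translate n (Forall x p) = Forall x (translate n p)"

lemma sat_translate:
  assumes "exponential_field E"
  shows "quantifier_free p \<Longrightarrow> \<forall>x\<in>free_vars aterm_vars p. x < n \<Longrightarrow>
    sat UNIV (\<le>) (eterm_eval E) (translate n p) v \<longleftrightarrow>
    sat UNIV (\<le>) (aterm_eval (field_struct E)) p v"
proof (induction p)
  case (Eq s t)
  have b: "\<forall>x\<in>aterm_vars s. x < n + 1" "\<forall>x\<in>aterm_vars t. x < n + 1"
    using Eq.prems by (auto simp: less_Suc_eq)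
  show ?case
    using Eq.prems sat_value_fm[OF assms b(1)] sat_value_fm[OF assms b(2)] by (auto simp: aterm_eval_upd[where n = n] fun_upd_same fun_upd_other
      simp del: fun_upd_apply)
next
  case (Le s t)
  have b: "\<forall>x\<in>aterm_vars s. x < n + 2" "\<forall>x\<in>aterm_vars t. x < n + 2"
    using Le.prems by (auto intro: less_SucI)
  show ?case
    using Le.prems sat_value_fm[OF assms b(1)] sat_value_fm[OF assms b(2)] by (auto simp: aterm_eval_upd[where n = n] fun_upd_same fun_upd_other
      simp del: fun_upd_apply)
qed auto

text \<open>The breakpoints are required to be elements of the field. Merely bounding the number of
  alternations of \<open>P\<close> would allow cuts, at which induction can fail.\<close>

primrec cells :: "('a::linorder \<Rightarrow> bool) \<Rightarrow> nat \<Rightarrow> 'a \<Rightarrow> bool" where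
  "cells P 0 c \<longleftrightarrow> (\<forall>x>c. P x) \<or> (\<forall>x>c. \<not> P x)"
| "cells P (Suc n) c \<longleftrightarrow>
     (\<exists>z\<ge>c. ((\<forall>x>c. x < z \<longrightarrow> P x) \<or> (\<forall>x>c. x < z \<longrightarrow> \<not> P x)) \<and> cells P n z)"

text \<open>Rounding \<open>c\<close> down to \<open>l\<close> gives \<open>P l\<close>, and one
  step reaches \<open>l + 1\<close>, the first element of \<open>M\<close> beyond \<open>c\<close>.
  If it lies in the cell after \<open>c\<close>, it decides \<open>P\<close> on that whole cell;
  otherwise the cell contains no element of \<open>M\<close>.\<close>

lemma cells_induct:
  assumes M: "integer_part M"
    and step: "\<And>m. m \<in> nonneg_part M \<Longrightarrow> P m \<Longrightarrow> P (m + 1)"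
  shows "cells P n c \<Longrightarrow> 0 \<le> c \<Longrightarrow> (\<And>m. m \<in> nonneg_part M \<Longrightarrow> m \<le> c \<Longrightarrow> P m) \<Longrightarrow>
    m \<in> nonneg_part M \<Longrightarrow> P m"
proof (induction n arbitrary: c m)
  case 0
  obtain l where l: "l \<in> M" "l \<le> c" "c < l + 1"
    using M unfolding integer_part_def by blast
  have "0 < l + 1" "l + 1 \<in> M"
    using l 0 M by (auto simp: integer_part_def discretely_ordered_subring_def)
  then have "1 \<le> l + 1"
    using M by (auto simp: integer_part_def discretely_ordered_subring_def)
  then have "l \<in> nonneg_part M" using l by (simp add: nonneg_part_def)
  then have "P (l + 1)" using step 0 l by blast
  then have "P x" if "c < x" for x using 0(1) l that by auto
  then show ?case using 0(3)[of m] 0(4) by (meson not_le)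
next
  case (Suc n)
  have sub: "m - 1 \<in> nonneg_part M" if "m \<in> nonneg_part M" "0 < m" for m
  proof -
    have "m \<in> M" "1 \<le> m"
      using that M by (auto simp: nonneg_part_def integer_part_def discretely_ordered_subring_def)
    moreover have "m + - 1 \<in> M"
      using M \<open>m \<in> M\<close> unfolding integer_part_def discretely_ordered_subring_def by blast
    ultimately show ?thesis by (simp add: nonneg_part_def)
  qed
  obtain l where l: "l \<in> M" "l \<le> c" "c < l + 1"
    using M unfolding integer_part_def by blast
  have l1: "0 < l + 1" "l + 1 \<in> M"
    using l Suc.prems M by (auto simp: integer_part_def discretely_ordered_subring_def)
  then have "1 \<le> l + 1"
    using M by (auto simp: integer_part_def discretely_ordered_subring_def)
  then have "l \<in> nonneg_part M" using l by (simp add: nonneg_part_def)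
  then have Pl: "P (l + 1)" using step Suc.prems l by blast
  obtain z where z: "c \<le> z" "cells P n z"
    "(\<forall>x>c. x < z \<longrightarrow> P x) \<or> (\<forall>x>c. x < z \<longrightarrow> \<not> P x)"
    using Suc.prems(1) by auto
  have gap: "P m" if m: "m \<in> nonneg_part M" "c < m" "m < z" for m
  proof -
    have "m \<in> M" using m by (simp add: nonneg_part_def)
    then have "m + - l \<in> M"
      using M l unfolding integer_part_def discretely_ordered_subring_def by blast
    moreover have "0 < m + - l" using l m by simp
    ultimately have "1 \<le> m + - l"
      using M unfolding integer_part_def discretely_ordered_subring_def by blast
    then have "l + 1 < z" using m by simp
    then show ?thesis using z(3) Pl l m by blast
  qed
  \<comment> \<open>The breakpoint \<open>z\<close> belongs to no open cell but may lie in
    \<open>M\<close>; then \<open>P z\<close> is reached from \<open>z - 1\<close>.\<close>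
  have upto: "P m" if m: "m \<in> nonneg_part M" "m \<le> z" for m
  proof (cases "m \<le> c")
    case False
    have m1: "m - 1 \<in> nonneg_part M" using sub m False Suc.prems(2) by simp
    have "P (m - 1)"
      using gap[OF m1] Suc.prems(3)[OF m1] m by (cases "m - 1 \<le> c") auto
    then show ?thesis using step[OF m1] by simp
  qed (use Suc.prems m in blast)
  show ?case using Suc.IH[OF z(2) _ upto] z(1) Suc.prems by auto
qed

section \<open>First-order expression of cells, and transfer\<close>

definition less_fm :: "nat \<Rightarrow> nat \<Rightarrow> eterm fm" where
  "less_fm x y = Neg (Le (EVar y) (EVar x))"

text \<open>Successive breakpoints occupy the variables \<open>c\<close>, \<open>c + 1\<close> and
  so on, so nested quantifiers do not clash. An implication from a negated universal formula encodes
  the disjunction in \<open>cells\<close>.\<close>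

primrec cells_fm :: "nat \<Rightarrow> eterm fm \<Rightarrow> nat \<Rightarrow> nat \<Rightarrow> eterm fm" where
  "cells_fm x p 0 c =
     Imp (Neg (Forall x (Imp (less_fm c x) p))) (Forall x (Imp (less_fm c x) (Neg p)))"
| "cells_fm x p (Suc n) c =
     Exists (c + 1) (Conj (Le (EVar c) (EVar (c + 1))) (Conj
       (Imp (Neg (Forall x (Imp (Conj (less_fm c x) (less_fm x (c + 1))) p)))
         (Forall x (Imp (Conj (less_fm c x) (less_fm x (c + 1))) (Neg p))))
       (cells_fm x p n (c + 1))))"

text \<open>Independence from variables \<open>\<ge> k\<close> is required semantically, because
  translated formulas do contain such variables, though only bound.\<close>

lemma sat_cells_fm:
  assumes "\<And>v m a. m \<ge> k \<Longrightarrow> sat UNIV (\<le>) (eterm_eval E) p (v(m := a)) \<longleftrightarrow> sat UNIV (\<le>) (eterm_eval E) p v"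
    and "x < k"
  shows "k \<le> c \<Longrightarrow> sat UNIV (\<le>) (eterm_eval E) (cells_fm x p n c) v \<longleftrightarrow>
    cells (\<lambda>a. sat UNIV (\<le>) (eterm_eval E) p (v(x := a))) n (v c)"
proof (induction n arbitrary: c v)
  case 0
  then have "c \<noteq> x" using assms(2) by simp
  then show ?case
    by (simp add: less_fm_def not_le fun_upd_same fun_upd_other del: fun_upd_apply)
next
  case (Suc n)
  have p: "sat UNIV (\<le>) (eterm_eval E) p (v(Suc c := z, x := a)) \<longleftrightarrow>
      sat UNIV (\<le>) (eterm_eval E) p (v(x := a))" for z a
    using assms(1)[of "Suc c" "v(x := a)" z] assms(2) Suc.prems by (simp add: fun_upd_twist)
  show ?case using Suc assms(2)
    by (simp add: less_fm_def not_le not_less p fun_upd_same fun_upd_other del: fun_upd_apply)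
      (simp add: imp_conv_disj not_less)
qed

lemma exp_holds_Forall: "exp_holds E (Forall x p) \<longleftrightarrow> exp_holds E p"
  unfolding exp_holds_def holds_def
  by (metis UNIV_I fun_upd_triv sat.simps(5) subset_UNIV)

lemma exp_holds_closure: "exp_holds E (foldr Forall xs p) \<longleftrightarrow> exp_holds E p"
  by (induction xs) (simp_all add: exp_holds_Forall)

lemma free_vars_closure: "free_vars tv (foldr Forall xs p) = free_vars tv p - set xs"
  by (induction xs) auto

text \<open>\<open>Th_R_exp2\<close> contains sentences only, so the universal closure is what is
  transferred.\<close>

lemma transfer_from_reals:
  assumes "exp_models E Th_R_exp2" "exp_holds (\<lambda>x::real. 2 powr x) p"
  shows "exp_holds E p"
proof -
  have "finite (free_vars eterm_vars p)"
    by (intro finite_free_vars finite_eterm_vars)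
  then obtain xs where "set xs = free_vars eterm_vars p"
    using finite_list by blast
  then have "foldr Forall xs p \<in> Th_R_exp2"
    using assms(2) by (simp add: Th_R_exp2_def exp_holds_closure free_vars_closure)
  then show ?thesis
    using assms(1) exp_holds_closure unfolding exp_models_def by blast
qed

text \<open>Relativizes to nonnegative parameters, since the sign dichotomy of terms fails for
  negative ones.\<close>

definition nonneg_imp :: "nat list \<Rightarrow> eterm fm \<Rightarrow> eterm fm" where
  "nonneg_imp ys p = foldr (\<lambda>y. Imp (Le EZero (EVar y))) ys p"

lemma sat_nonneg_imp:
  "sat UNIV (\<le>) (eterm_eval E) (nonneg_imp ys p) v \<longleftrightarrow>
    ((\<forall>y\<in>set ys. 0 \<le> v y) \<longrightarrow> sat UNIV (\<le>) (eterm_eval E) p v)"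
  unfolding nonneg_imp_def by (induction ys) auto

section \<open>Arithmetic terms over the reals\<close>

lemma exponential_field_powr: "exponential_field (\<lambda>x::real. 2 powr x)"
  unfolding exponential_field_def
proof (intro conjI allI)
  show "bij_betw (\<lambda>x::real. 2 powr x) UNIV {0<..}"
    by (rule bij_betw_byWitness[where f' = "log 2"]) auto
qed (simp_all add: powr_add)

abbreviation real_exp_struct :: "real arith_struct" where
  "real_exp_struct \<equiv> field_struct (\<lambda>x. 2 powr x)"

lemma field_pow_powr:
  "field_pow (\<lambda>x::real. 2 powr x) x y =
    (if 0 < x then exp (y * ln x) else if y = 0 then 1 else 0)"
proof -
  have "log_of (\<lambda>x::real. 2 powr x) x = log 2 x" if "0 < x"
    using log_of_E[OF exponential_field_powr, of "log 2 x"] that by simp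
  then show ?thesis by (simp add: field_pow_def powr_def log_def)
qed

text \<open>Absolute values make every assignment a legitimate parameter, so tame families need no
  side condition on \<open>v\<close>.\<close>

definition real_term :: "nat \<Rightarrow> aterm \<Rightarrow> (nat \<Rightarrow> real) \<Rightarrow> real \<Rightarrow> real" where
  "real_term x t v a = aterm_eval real_exp_struct ((\<lambda>i. \<bar>v i\<bar>)(x := a)) t"

lemma real_term_simps [simp]:
  "real_term x (AVar y) v a = (if y = x then a else \<bar>v y\<bar>)"
  "real_term x AZero v a = 0"
  "real_term x (ASuc t) v a = real_term x t v a + 1"
  "real_term x (AAdd s t) v a = real_term x s v a + real_term x t v a"
  "real_term x (AMul s t) v a = real_term x s v a * real_term x t v a"
  "real_term x (APow s t) v a =
    (if 0 < real_term x s v a then exp (real_term x t v a * ln (real_term x s v a))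
     else if real_term x t v a = 0 then 1 else 0)"
  by (simp_all add: real_term_def field_pow_powr)

text \<open>Every operation preserves the dichotomy. For a power, a positive base gives a positive
  value, and a zero base gives constantly 1 or 0 according to the dichotomy for the
  exponent.\<close>

lemma real_term_sign:
  "(\<forall>a>0. real_term x t v a = 0) \<or> (\<forall>a>0. real_term x t v a > 0)"
proof (induction t)
  case (AVar y)
  show ?case by (cases "v y = 0") auto
next
  case AZero
  show ?case by simp
next
  case (ASuc t)
  have "0 < real_term x t v a + 1" if "0 < a" for a
    using ASuc.IH that by (auto simp: add_pos_pos)
  then show ?case by simp
next
  case (AAdd s t)
  then show ?case by (elim disjE) (simp_all add: add_pos_pos)
next
  case (AMul s t)
  then show ?case by (elim disjE) simp_all
next
  case (APow s t)
  show ?case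
  proof (cases "\<forall>a>0. real_term x s v a = 0")
    case True
    then have "real_term x (APow s t) v a = (if real_term x t v a = 0 then 1 else 0)"
      if "0 < a" for a using that by simp
    then show ?thesis using APow.IH(2) by (metis less_irrefl zero_less_one)
  next
    case False
    then have "\<forall>a>0. real_term x s v a > 0" using APow.IH(1) by blast
    then have "real_term x (APow s t) v a > 0" if "0 < a" for a using that by simp
    then show ?thesis by blast
  qed
qed

text \<open>The starting ring is arbitrary so that a second term can be built over the ring of the
  first and both end up in a common ring.\<close>

lemma tame_extend_term:
  assumes "tame K" "(\<lambda>v a. a) \<in> K"
  shows "\<exists>K'. tame K' \<and> K \<subseteq> K' \<and>
    (\<exists>F\<in>K'. \<forall>v. \<forall>a>0. F v a = real_term x t v a)"
  using assms
proof (induction t arbitrary: K)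
  case (AVar y)
  then show ?case
    using tame_const[OF AVar(1), of "\<lambda>v. \<bar>v y\<bar>"]
    by (intro exI[of _ K]) (cases "y = x"; auto)
next
  case AZero
  then show ?case
    using tame_const[OF AZero(1), of "\<lambda>v. 0"] by (intro exI[of _ K]) auto
next
  case (ASuc t)
  obtain K' F where K': "tame K'" "K \<subseteq> K'" "F \<in> K'"
    "\<forall>v. \<forall>a>0. F v a = real_term x t v a"
    using ASuc.IH[OF ASuc.prems] by blast
  have "(\<lambda>v a. F v a + 1) \<in> K'" by (intro tame_add tame_const K')
  then show ?case using K' by (intro exI[of _ K'] conjI bexI[of _ "\<lambda>v a. F v a + 1"]) auto
next
  case (AAdd s t)
  obtain K1 F where K1: "tame K1" "K \<subseteq> K1" "F \<in> K1"
    "\<forall>v. \<forall>a>0. F v a = real_term x s v a"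
    using AAdd.IH(1)[OF AAdd.prems] by blast
  obtain K2 G where K2: "tame K2" "K1 \<subseteq> K2" "G \<in> K2"
    "\<forall>v. \<forall>a>0. G v a = real_term x t v a"
    using AAdd.IH(2)[OF K1(1)] AAdd.prems K1(2) by blast
  have "(\<lambda>v a. F v a + G v a) \<in> K2" using K1 K2 by (intro tame_add) auto
  then show ?case using K1 K2
    by (intro exI[of _ K2] conjI bexI[of _ "\<lambda>v a. F v a + G v a"]) auto
next
  case (AMul s t)
  obtain K1 F where K1: "tame K1" "K \<subseteq> K1" "F \<in> K1"
    "\<forall>v. \<forall>a>0. F v a = real_term x s v a"
    using AMul.IH(1)[OF AMul.prems] by blast
  obtain K2 G where K2: "tame K2" "K1 \<subseteq> K2" "G \<in> K2"
    "\<forall>v. \<forall>a>0. G v a = real_term x t v a"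
    using AMul.IH(2)[OF K1(1)] AMul.prems K1(2) by blast
  have "(\<lambda>v a. F v a * G v a) \<in> K2" using K1 K2 by (intro tame_mult) auto
  then show ?case using K1 K2
    by (intro exI[of _ K2] conjI bexI[of _ "\<lambda>v a. F v a * G v a"]) auto
next
  case (APow s t)
  obtain K1 F where K1: "tame K1" "K \<subseteq> K1" "F \<in> K1" "\<forall>v. \<forall>a>0. F v a = real_term x s v a"
    using APow.IH(1)[OF APow.prems] by blast
  obtain K2 G where K2: "tame K2" "K1 \<subseteq> K2" "G \<in> K2" "\<forall>v. \<forall>a>0. G v a = real_term x t v a"
    using APow.IH(2)[OF K1(1)] APow.prems K1(2) by blast
  \<comment> \<open>Indicators of the parameters at which base or exponent vanishes identically.
    \<open>S\<close> replaces such a base by 1 and is therefore positive for all parameters.\<close>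
  define zs where "zs v = (if \<forall>a>0. real_term x s v a = 0 then 1 else 0 :: real)" for v
  define zt where "zt v = (if \<forall>a>0. real_term x t v a = 0 then 1 else 0 :: real)" for v
  define S where "S v a = zs v + (1 - zs v) * F v a" for v a
  have S: "S \<in> K2"
    unfolding S_def[abs_def] using K1 K2
    by (intro tame_add[OF K2(1)] tame_mult[OF K2(1)] tame_const[OF K2(1)]) auto
  have S_pos: "0 < S v a" if "0 < a" for v a
    using real_term_sign[of x s v] K1(4) that by (auto simp: S_def zs_def)
  \<comment> \<open>The derivative of \<open>ln S\<close> is \<open>S' / S\<close>, so the
    reciprocal is adjoined before the logarithm.\<close>
  define K3 where "K3 = adjoin K2 (\<lambda>v a. inverse (S v a))"
  have K3: "tame K3" "K2 \<subseteq> K3" "(\<lambda>v a. inverse (S v a)) \<in> K3"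
    unfolding K3_def
    by (rule tame_adjoin_inverse[OF K2(1) S S_pos], assumption, rule subset_adjoin[OF K2(1)],
        rule self_adjoin[OF K2(1)])
  obtain S' where S': "S' \<in> K2" "\<And>v a. 0 < a \<Longrightarrow> (S v has_real_derivative S' v a) (at a)"
    using tame_deriv[OF K2(1) S] by blast
  define K4 where "K4 = adjoin K3 (\<lambda>v a. ln (S v a))"
  have S'': "(\<lambda>v a. inverse (S v a) * S' v a) \<in> K3"
    using K3 S' by (intro tame_mult) auto
  have ln_S: "((\<lambda>a. ln (S v a)) has_real_derivative inverse (S v a) * S' v a) (at a)"
    if "0 < a" for v a
    by (rule DERIV_chain2[OF DERIV_ln[OF S_pos[OF that]] S'(2)[OF that]])
  have K4: "tame K4" "K3 \<subseteq> K4" "(\<lambda>v a. ln (S v a)) \<in> K4"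
    unfolding K4_def
    by (rule tame_adjoin_antiderivative[OF K3(1) S'' ln_S], assumption,
        rule subset_adjoin[OF K3(1)], rule self_adjoin[OF K3(1)])
  define K5 where "K5 = adjoin K4 (\<lambda>v a. exp (G v a * ln (S v a)))"
  have "(\<lambda>v a. G v a * ln (S v a)) \<in> K4"
    using K2 K3 K4 by (intro tame_mult) auto
  note K5 = tame_adjoin_exp[OF K4(1) this, folded K5_def]
    subset_adjoin[OF K4(1), of "\<lambda>v a. exp (G v a * ln (S v a))", folded K5_def]
    self_adjoin[OF K4(1), of "\<lambda>v a. exp (G v a * ln (S v a))", folded K5_def]
  \<comment> \<open>For a vanishing base the factor \<open>zt\<close> supplies the values of
    \<open>0^0\<close> and \<open>0^y\<close>.\<close>
  define H where "H v a = zs v * zt v + (1 - zs v) * exp (G v a * ln (S v a))" for v a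
  have "H \<in> K5"
    unfolding H_def[abs_def]
    by (intro tame_add[OF K5(1)] tame_mult[OF K5(1)] tame_const[OF K5(1)] K5)
  moreover have "H v a = real_term x (APow s t) v a" if a: "0 < a" for v a
  proof (cases "\<forall>a>0. real_term x s v a = 0")
    case True
    moreover have "zt v = (if real_term x t v a = 0 then 1 else 0)"
      using real_term_sign[of x t v] a by (auto simp: zt_def)
    ultimately show ?thesis using a by (simp add: H_def zs_def)
  next
    case False
    have "0 < real_term x s v a" using False real_term_sign[of x s v] a by blast
    moreover have "zs v = 0" using False by (simp only: zs_def if_False)
    ultimately show ?thesis using a K1(4) K2(4) by (simp add: H_def S_def)
  qed
  moreover have "K \<subseteq> K5"
    using K1(2) K2(2) K3(2) K4(2) K5(2) by blast
  ultimately show ?case using K5(1) by blast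
qed

lemma piecewise_const_comp:
  assumes "piecewise_const n f" "\<And>x. 0 < x \<Longrightarrow> k x = h (f x)"
  shows "piecewise_const n k"
  using piecewise_const_comp2[OF assms(1) piecewise_const_const[of 0 0], of k "\<lambda>r _. h r"] assms(2)
  by simp

text \<open>Subtraction is absent from the language but available in a tame ring. The ring starts
  from the constants by adjoining the identity, an antiderivative of 1.\<close>

lemma real_term_diff_piecewise_const:
  "\<exists>N. \<forall>v. piecewise_const N (\<lambda>a. sgn (real_term x s v a - real_term x t v a))"
proof -
  define C where "C = range (\<lambda>c (v :: nat \<Rightarrow> real) (a::real). (c v :: real))"
  define K where "K = adjoin C (\<lambda>v a. a)"
  have C: "tame C" unfolding C_def by (rule tame_constants)
  have K: "tame K" "(\<lambda>v a. a) \<in> K"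
    unfolding K_def
    using tame_adjoin_antiderivative[OF C tame_const[OF C, of "\<lambda>v. 1"], of "\<lambda>v a. a"]
      self_adjoin[OF C] by auto
  obtain K1 F where K1: "tame K1" "K \<subseteq> K1" "F \<in> K1"
    "\<forall>v. \<forall>a>0. F v a = real_term x s v a"
    using tame_extend_term[OF K] by blast
  obtain K2 G where K2: "tame K2" "K1 \<subseteq> K2" "G \<in> K2"
    "\<forall>v. \<forall>a>0. G v a = real_term x t v a"
    using tame_extend_term[OF K1(1)] K(2) K1(2) by blast
  have "(\<lambda>v a. F v a - G v a) \<in> K2"
    using K1 K2 by (intro tame_diff) auto
  then obtain N where N: "\<And>v. piecewise_const N (\<lambda>a. sgn (F v a - G v a))"
    using tame_piecewise_const[OF K2(1)] by blast
  show ?thesis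
    by (intro exI[of _ N] allI piecewise_const_cong[OF N]) (simp add: K1 K2)
qed

lemma sat_piecewise_const:
  "quantifier_free p \<Longrightarrow> \<exists>N. \<forall>v. piecewise_const N
    (\<lambda>a. sat UNIV (\<le>) (aterm_eval real_exp_struct) p ((\<lambda>i. \<bar>v i\<bar>)(x := a)))"
proof (induction p)
  case (Eq s t)
  obtain N where N: "\<And>v. piecewise_const N (\<lambda>a. sgn (real_term x s v a - real_term x t v a))"
    using real_term_diff_piecewise_const by blast
  have "piecewise_const N (\<lambda>a. real_term x s v a = real_term x t v a)" for v
    by (rule piecewise_const_comp[OF N[of v], where h = "\<lambda>r. r = 0"]) (simp add: sgn_0_0)
  then show ?case unfolding real_term_def sat.simps by blast
next
  case (Le s t)
  obtain N where N: "\<And>v. piecewise_const N (\<lambda>a. sgn (real_term x s v a - real_term x t v a))"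
    using real_term_diff_piecewise_const by blast
  have "piecewise_const N (\<lambda>a. real_term x s v a \<le> real_term x t v a)" for v
    by (rule piecewise_const_comp[OF N[of v], where h = "\<lambda>r. r \<le> 0"]) (simp add: sgn_real_def)
  then show ?case unfolding real_term_def sat.simps by blast
next
  case (Neg p)
  have "quantifier_free p" using Neg.prems by simp
  then obtain N where N: "\<And>v. piecewise_const N
    (\<lambda>a. sat UNIV (\<le>) (aterm_eval real_exp_struct) p ((\<lambda>i. \<bar>v i\<bar>)(x := a)))"
    using Neg.IH by blast
  show ?case
    unfolding sat.simps by (intro exI[of _ N] allI piecewise_const_comp[OF N]) (rule refl)
next
  case (Conj p q)
  have "quantifier_free p" "quantifier_free q" using Conj.prems by auto
  then obtain M N where MN: "\<And>v. piecewise_const M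
      (\<lambda>a. sat UNIV (\<le>) (aterm_eval real_exp_struct) p ((\<lambda>i. \<bar>v i\<bar>)(x := a)))"
    "\<And>v. piecewise_const N
      (\<lambda>a. sat UNIV (\<le>) (aterm_eval real_exp_struct) q ((\<lambda>i. \<bar>v i\<bar>)(x := a)))"
    using Conj.IH by metis
  show ?case
    unfolding sat.simps
    by (intro exI[of _ "M + N"] allI piecewise_const_comp2[OF MN, where h = "(\<and>)"]) (rule refl)
qed simp

section \<open>From breakpoint sets to cells\<close>

lemma cells_if_constant: "(\<And>x y. c < x \<Longrightarrow> c < y \<Longrightarrow> P x = P y) \<Longrightarrow> cells P n c"
proof (induction n)
  case 0
  then show ?case unfolding cells.simps by blast
next
  case (Suc n)
  then have "cells P n c" by blast
  \<comment> \<open>The witness \<open>c\<close> makes the cell empty, so surplus breakpoints cost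
    nothing.\<close>
  then show ?case by (auto intro!: exI[of _ c])
qed

text \<open>The least breakpoint above \<open>c\<close> ends the first cell. Beyond it only points
  greater than \<open>z\<close> matter, so \<open>z\<close> can be removed from \<open>Z\<close> and
  the count drops.\<close>

lemma cells_if_breakpoints:
  fixes c :: real
  shows "finite Z \<Longrightarrow> card Z \<le> n \<Longrightarrow>
    (\<And>x y. c < x \<Longrightarrow> x < y \<Longrightarrow> Z \<inter> {x..y} = {} \<Longrightarrow> P x = P y) \<Longrightarrow> cells P n c"
proof (induction n arbitrary: Z c)
  case 0
  then have "P x = P y" if "c < x" "c < y" for x y
  proof -
    have "Z = {}" using 0(1,2) by simp
    then show ?thesis
      using 0(3)[of x y] 0(3)[of y x] that by (metis Int_empty_left linorder_neqE)
  qed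
  then show ?case by (rule cells_if_constant)
next
  case (Suc n)
  show ?case
  proof (cases "Z \<inter> {c<..} = {}")
    case True
    have "P x = P y" if "c < x" "c < y" for x y
    proof -
      have "Z \<inter> {x..y} = {}" "Z \<inter> {y..x} = {}" using True that by auto
      then show ?thesis
        using Suc.prems(3)[of x y] Suc.prems(3)[of y x] that by (metis linorder_neqE)
    qed
    then show ?thesis by (rule cells_if_constant)
  next
    case False
    define z where "z = Min (Z \<inter> {c<..})"
    have z: "z \<in> Z" "c < z" and least: "\<And>y. y \<in> Z \<Longrightarrow> c < y \<Longrightarrow> z \<le> y"
      using Min_in[of "Z \<inter> {c<..}"] False Suc.prems(1) by (auto simp: z_def)
    have "P x = P y" if "c < x" "x < z" "c < y" "y < z" for x y
    proof -
      have "Z \<inter> {x..y} = {}" "Z \<inter> {y..x} = {}" using least that by force+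
      then show ?thesis
        using Suc.prems(3)[of x y] Suc.prems(3)[of y x] that by (metis linorder_neqE)
    qed
    then have gap: "(\<forall>x>c. x < z \<longrightarrow> P x) \<or> (\<forall>x>c. x < z \<longrightarrow> \<not> P x)" by blast
    have "cells P n z"
    proof (rule Suc.IH[of "Z - {z}"])
      show "card (Z - {z}) \<le> n" using Suc.prems z by simp
      show "P x = P y" if "z < x" "x < y" "(Z - {z}) \<inter> {x..y} = {}" for x y
      proof -
        have "Z \<inter> {x..y} = {}" using that by auto
        then show ?thesis using Suc.prems(3)[of x y] that z(2) by simp
      qed
    qed (use Suc.prems(1) in simp)
    then show ?thesis using gap z(2) by (auto intro: less_imp_le)
  qed
qed

lemma real_cells:
  assumes "quantifier_free p"
  obtains N where "\<And>v c. (\<And>i. i \<in> free_vars aterm_vars p \<Longrightarrow> 0 \<le> v i) \<Longrightarrow> 0 \<le> c \<Longrightarrow>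
    cells (\<lambda>a. sat UNIV (\<le>) (aterm_eval real_exp_struct) p (v(x := a))) N c"
proof -
  obtain N where N: "\<And>v. piecewise_const N
      (\<lambda>a. sat UNIV (\<le>) (aterm_eval real_exp_struct) p ((\<lambda>i. \<bar>v i\<bar>)(x := a)))"
    using sat_piecewise_const[OF assms] by blast
  show thesis
  proof (rule that)
    fix v :: "nat \<Rightarrow> real" and c :: real
    assume v: "\<And>i. i \<in> free_vars aterm_vars p \<Longrightarrow> 0 \<le> v i" and c: "0 \<le> c"
    have eq: "sat UNIV (\<le>) (aterm_eval real_exp_struct) p ((\<lambda>i. \<bar>v i\<bar>)(x := a)) =
        sat UNIV (\<le>) (aterm_eval real_exp_struct) p (v(x := a))" for a
      using v by (intro sat_cong_quantifier_free assms) auto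
    obtain Z where "finite Z" "card Z \<le> N"
      "const_off Z (\<lambda>a. sat UNIV (\<le>) (aterm_eval real_exp_struct) p (v(x := a)))"
      using N[of v] unfolding piecewise_const_def eq by blast
    then show "cells (\<lambda>a. sat UNIV (\<le>) (aterm_eval real_exp_struct) p (v(x := a))) N c"
      using c by (intro cells_if_breakpoints) (auto simp: const_off_def)
  qed
qed

section \<open>Transfer to the exponential field\<close>

text \<open>Variables below \<open>n\<close> hold the parameters and \<open>n\<close> holds the
  starting point, hence the list \<open>[0..<Suc n]\<close>.\<close>

lemma sat_cells_translate:
  assumes "exponential_field E" "quantifier_free p" "\<forall>i\<in>free_vars aterm_vars p. i < n" "x < n"
  shows "sat UNIV (\<le>) (eterm_eval E) (nonneg_imp [0..<Suc n] (cells_fm x (translate n p) N n)) v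
    \<longleftrightarrow> ((\<forall>i\<le>n. 0 \<le> v i) \<longrightarrow>
      cells (\<lambda>a. sat UNIV (\<le>) (aterm_eval (field_struct E)) p (v(x := a))) N (v n))"
proof -
  have tr: "sat UNIV (\<le>) (eterm_eval E) (translate n p) w \<longleftrightarrow>
      sat UNIV (\<le>) (aterm_eval (field_struct E)) p w" for w
    using sat_translate assms by blast
  have "sat UNIV (\<le>) (eterm_eval E) (translate n p) (w(m := a)) \<longleftrightarrow>
      sat UNIV (\<le>) (eterm_eval E) (translate n p) w" if "n \<le> m" for w m a
    unfolding tr using assms(3) that by (intro sat_cong_quantifier_free[OF assms(2)]) auto
  note sat_cells_fm[OF this assms(4) order_refl]
  then have "sat UNIV (\<le>) (eterm_eval E) (cells_fm x (translate n p) N n) v \<longleftrightarrow>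
      cells (\<lambda>a. sat UNIV (\<le>) (aterm_eval (field_struct E)) p (v(x := a))) N (v n)"
    by (simp add: tr)
  then show ?thesis by (auto simp: sat_nonneg_imp less_Suc_eq_le simp del: upt_Suc)
qed

text \<open>\<open>N\<close> comes from the reals and enters the transferred formula as the number
  of nested breakpoint quantifiers, so uniformity in \<open>v\<close> is what makes a single formula
  suffice.\<close>

lemma transferred_cells:
  assumes E: "exponential_field E" "exp_models E Th_R_exp2" and p: "quantifier_free p"
  obtains N where "\<And>v. (\<And>i. 0 \<le> v i) \<Longrightarrow>
    cells (\<lambda>a. sat UNIV (\<le>) (aterm_eval (field_struct E)) p (v(x := a))) N 0"
proof -
  have "finite (insert x (free_vars aterm_vars p))"
    by (simp add: finite_free_vars finite_aterm_vars)
  then obtain n where n: "\<forall>i\<in>free_vars aterm_vars p. i < n" "x < n"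
    using finite_nat_set_iff_bounded by (metis insert_iff)
  obtain N where N: "\<And>v c. (\<And>i. i \<in> free_vars aterm_vars p \<Longrightarrow> 0 \<le> v i) \<Longrightarrow> 0 \<le> c \<Longrightarrow>
      cells (\<lambda>a. sat UNIV (\<le>) (aterm_eval real_exp_struct) p (v(x := a))) N c"
    using real_cells[OF p] by blast
  let ?q = "nonneg_imp [0..<Suc n] (cells_fm x (translate n p) N n)"
  have "exp_holds (\<lambda>x::real. 2 powr x) ?q"
    unfolding exp_holds_def holds_def sat_cells_translate[OF exponential_field_powr p n]
    using n N by (auto simp: less_imp_le)
  then have "exp_holds E ?q" by (rule transfer_from_reals[OF E(2)])
  then have cells: "(\<forall>i\<le>n. 0 \<le> v i) \<longrightarrow>
      cells (\<lambda>a. sat UNIV (\<le>) (aterm_eval (field_struct E)) p (v(x := a))) N (v n)" for v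
    unfolding exp_holds_def holds_def sat_cells_translate[OF E(1) p n] by simp
  show thesis
  proof (rule that)
    fix v :: "nat \<Rightarrow> 'a" assume v: "\<And>i. 0 \<le> v i"
    \<comment> \<open>The variable \<open>n\<close> does not occur in \<open>p\<close>, so it may be
      set to 0 to start the cells there.\<close>
    have "sat UNIV (\<le>) (aterm_eval (field_struct E)) p (v(n := 0, x := a)) =
        sat UNIV (\<le>) (aterm_eval (field_struct E)) p (v(x := a))" for a
      using n by (intro sat_cong_quantifier_free[OF p]) auto
    then show "cells (\<lambda>a. sat UNIV (\<le>) (aterm_eval (field_struct E)) p (v(x := a))) N 0"
      using cells[of "v(n := 0)"] v by simp
  qed
qed

section \<open>Passing between the nonnegative integer part and the field\<close>

lemma aterm_eval_in_univ:
  assumes "is_structure A" "range v \<subseteq> univ A"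
  shows "aterm_eval A v t \<in> univ A"
  using assms by (induction t) (auto simp: is_structure_def)

lemma aterm_eval_nonneg_struct:
  assumes "is_structure (nonneg_struct M pw)" "range v \<subseteq> nonneg_part M"
    and pw: "\<And>x y. x \<in> nonneg_part M \<Longrightarrow> y \<in> nonneg_part M \<Longrightarrow> pw x y = field_pow E x y"
  shows "aterm_eval (nonneg_struct M pw) v t = aterm_eval (field_struct E) v t"
proof (induction t)
  case (APow s t)
  have "aterm_eval (nonneg_struct M pw) v u \<in> nonneg_part M" for u
    using aterm_eval_in_univ[OF assms(1), of v u] assms(2) by (simp add: nonneg_struct_def)
  from pw[OF this[of s] this[of t]] APow show ?case by (simp add: nonneg_struct_def)
qed (simp_all add: nonneg_struct_def)

text \<open>Without quantifiers the universe is irrelevant, so the induction formula extends to all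
  points of the field, where the breakpoints live.\<close>

lemma sat_nonneg_struct:
  assumes "is_structure (nonneg_struct M pw)" "range v \<subseteq> nonneg_part M"
    and "\<And>x y. x \<in> nonneg_part M \<Longrightarrow> y \<in> nonneg_part M \<Longrightarrow> pw x y = field_pow E x y"
  shows "quantifier_free p \<Longrightarrow> sat U (\<le>) (aterm_eval (nonneg_struct M pw)) p v \<longleftrightarrow>
    sat UNIV (\<le>) (aterm_eval (field_struct E)) p v"
  by (induction p) (simp_all add: aterm_eval_nonneg_struct[OF assms])

lemma nonneg_struct_induction:
  assumes E: "exponential_field E" "exp_models E Th_R_exp2"
    and M: "integer_part M" and A: "is_structure (nonneg_struct M pw)"
    and pw: "\<And>x y. x \<in> nonneg_part M \<Longrightarrow> y \<in> nonneg_part M \<Longrightarrow> pw x y = field_pow E x y"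
    and p: "quantifier_free p" and v: "range v \<subseteq> nonneg_part M"
  shows "sat (nonneg_part M) (\<le>) (aterm_eval (nonneg_struct M pw)) (induction_axiom x p) v"
proof -
  let ?sat = "sat (nonneg_part M) (\<le>) (aterm_eval (nonneg_struct M pw))"
  define P where "P a = sat UNIV (\<le>) (aterm_eval (field_struct E)) p (v(x := a))" for a
  have P: "?sat p (v(x := a)) \<longleftrightarrow> P a" if "a \<in> nonneg_part M" for a
    unfolding P_def using v that by (intro sat_nonneg_struct[OF A _ pw p]) auto
  have "0 \<in> nonneg_part M"
    using M by (simp add: nonneg_part_def integer_part_def discretely_ordered_subring_def)
  then have zero: "?sat (fm_subst x AZero p) v \<longleftrightarrow> P 0"
    unfolding sat_subst_quantifier_free[OF p] by (simp add: P[symmetric] nonneg_struct_def)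
  have Suc: "?sat (fm_subst x (ASuc (AVar x)) p) (v(x := a)) \<longleftrightarrow> P (a + 1)"
    if "a \<in> nonneg_part M" for a
  proof -
    have "a + 1 \<in> nonneg_part M"
      using A that by (simp add: is_structure_def nonneg_struct_def)
    then show ?thesis
      unfolding sat_subst_quantifier_free[OF p] by (simp add: P[symmetric] nonneg_struct_def)
  qed
  have "P m" if "P 0" "\<forall>a\<in>nonneg_part M. P a \<longrightarrow> P (a + 1)" "m \<in> nonneg_part M" for m
  proof -
    have "0 \<le> v i" for i using v by (auto simp: nonneg_part_def)
    then obtain N where "cells P N 0"
      unfolding P_def[abs_def] using transferred_cells[OF E p] by metis
    \<comment> \<open>The only element of \<open>nonneg_part M\<close> at or below 0 is 0, so
      \<open>P 0\<close> starts \<open>cells_induct\<close> at \<open>c = 0\<close>.\<close>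
    then show ?thesis
      using cells_induct[OF M, of P N 0 m] that by (auto simp: nonneg_part_def)
  qed
  then show ?thesis by (auto simp: induction_axiom_def zero Suc P)
qed

theorem theorem2p3:
  fixes E :: "'a::linordered_field \<Rightarrow> 'a"
    and M :: "'a set"
    and pw :: "'a \<Rightarrow> 'a \<Rightarrow> 'a"
  assumes "exponential_field E"
    and "exp_models E Th_R_exp2"
    and "discretely_ordered_subring M"
    and "\<forall>x\<in>nonneg_part M. \<forall>y\<in>nonneg_part M. pw x y \<in> nonneg_part M"
    and "xy_integer_part M pw E"
  shows "arith_model (nonneg_struct M pw) IOpen_xy"
proof -
  have ip: "integer_part M"
    and pw_pos: "\<And>n m. n \<in> nonneg_part M \<Longrightarrow> m \<in> nonneg_part M \<Longrightarrow> 0 < n \<Longrightarrow>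
      pw n m = E (m * log_of E n)"
    and pw_00: "pw 0 0 = 1" and pw_0: "\<And>m. m \<in> M \<Longrightarrow> 0 < m \<Longrightarrow> pw 0 m = 0"
    using assms(5) by (auto simp: xy_integer_part_def)
  have pw: "pw x y = field_pow E x y" if "x \<in> nonneg_part M" "y \<in> nonneg_part M" for x y
    using that pw_pos pw_00 pw_0 by (auto simp: field_pow_def nonneg_part_def not_less)
  have ring: "0 \<in> M" "1 \<in> M" "\<And>x y. x \<in> M \<Longrightarrow> y \<in> M \<Longrightarrow> x + y \<in> M"
    "\<And>x y. x \<in> M \<Longrightarrow> y \<in> M \<Longrightarrow> x * y \<in> M" "\<And>x y. x \<in> M \<Longrightarrow> y \<in> M \<Longrightarrow> x - y \<in> M"
    "\<And>x. x \<in> M \<Longrightarrow> 0 < x \<Longrightarrow> 1 \<le> x"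
    using assms(3) unfolding discretely_ordered_subring_def
    by (auto simp flip: add_uminus_conv_diff)
  have A: "is_structure (nonneg_struct M pw)"
    using ring assms(4) by (simp add: is_structure_def nonneg_struct_def nonneg_part_def)
  have E: "E (x + y) = E x * E y" for x y
    using assms(1) by (simp add: exponential_field_def)
  have "E 0 = 1" using E[of 0 0] E_pos[OF assms(1), of 0] by simp
  then have pow_0: "pw x 0 = 1" if "x \<in> nonneg_part M" for x
    using that pw[of x 0] ring(1) by (simp add: field_pow_def nonneg_part_def)
  \<comment> \<open>For \<open>y = 0\<close> both sides are 0, because \<open>x + 1\<close> is not
    0.\<close>
  have pow_Suc: "pw y (x + 1) = pw y x * y" if "x \<in> nonneg_part M" "y \<in> nonneg_part M" for x y
  proof -
    have x1: "x + 1 \<in> nonneg_part M" using that ring by (auto simp: nonneg_part_def)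
    show ?thesis
      unfolding pw[OF that(2) x1] pw[OF that(2,1)]
      using that E_log_of[OF assms(1), of y]
      by (auto simp: field_pow_def distrib_right E nonneg_part_def)
  qed
  have "holds (nonneg_part M) (\<le>) (aterm_eval (nonneg_struct M pw)) p" if "p \<in> IOpen_xy" for p
    unfolding holds_def
  proof (intro allI impI)
    fix v :: "nat \<Rightarrow> 'a" assume v: "range v \<subseteq> nonneg_part M"
    then have v: "v i \<in> M" "0 \<le> v i" "v i \<in> nonneg_part M" for i
      by (auto simp: nonneg_part_def)
    \<comment> \<open>Stated in the form that Q3 takes once \<open>Exists\<close> is unfolded into a
      negated \<open>Forall\<close>.\<close>
    have pred: "(\<forall>y\<in>nonneg_part M. v i \<noteq> y + 1) \<longleftrightarrow> v i = 0" for i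
    proof (cases "v i = 0")
      case True
      have "y + 1 \<noteq> 0" if "y \<in> nonneg_part M" for y
        using that add_nonneg_pos[of y 1] by (auto simp: nonneg_part_def)
      then show ?thesis using True by metis
    next
      case False
      then have "v i - 1 \<in> nonneg_part M"
        using ring(5)[OF v(1) ring(2), of i] ring(6)[OF v(1), of i] v(2)[of i]
        by (simp add: nonneg_part_def)
      then show ?thesis using False by (metis diff_add_cancel)
    qed
    have diff: "v i \<le> v j \<longleftrightarrow> (\<exists>r\<in>nonneg_part M. r + v i = v j)" for i j
      using ring(5)[OF v(1) v(1), of j i]
      by (auto simp: nonneg_part_def intro!: bexI[of _ "v j - v i"])
    have "v i + 1 \<noteq> 0" for i using v(2)[of i] by linarith
    show "sat (nonneg_part M) (\<le>) (aterm_eval (nonneg_struct M pw)) p v"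
    proof (cases "\<exists>x q. p = induction_axiom x q \<and> quantifier_free q")
      case True
      then show ?thesis
        using nonneg_struct_induction[OF assms(1,2) ip A pw] v(3) by blast
    next
      case False
      then show ?thesis
        using \<open>p \<in> IOpen_xy\<close> v \<open>\<And>i. v i + 1 \<noteq> 0\<close>
        unfolding IOpen_xy_def Let_def
        by (auto simp: nonneg_struct_def pow_0 pow_Suc pred diff add.assoc distrib_left)
    qed
  qed
  then show ?thesis
    using A by (simp add: arith_model_def nonneg_struct_def)
qed

end
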